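(* Let $G$ be a connected graph such that $G$ has diameter at least $3$ or $\alpha(G)\geq 3$, let $f$ be an optimal independent broadcast on $G$, and let $f_{\max}=\max\{f(x):x\in V(G)\}$. Then $$\alpha_b(G)\leq 4\alpha(G)-4\min\left\{1,\frac{2\alpha(G)}{f_{\max}+2}\right\}.$$ Moreover, equality holds in this inequality if and only if $G\in\mathcal{G}_0\cup\mathcal{G}_2$.
   Context: All graphs are finite, simple, and undirected. $\mathbb{N}_0$ is the set of nonnegative integers; $[k]$ is the set of positive integers at most $k$, and $[k]_0=\{0\}\cup[k]$. $\mathrm{dist}_G$ denotes distance in $G$, $\mathrm{ecc}_G(x)$ the eccentricity of $x$ in $G$, and $\alpha(G)$ the independence number (maximum cardinality of a set of pairwise nonadjacent vertices). Broadcasts. For a connected graph $G$, a function $f:V(G)\to\mathbb{N}_0$ is an independent broadcast on $G$ if (B1) $f(x)\leq \mathrm{ecc}_G(x)$ for every vertex $x$ of $G$, and (B2) $\mathrm{dist}_G(x,y)>\max\{f(x),f(y)\}$ for every two distinct vertices $x,y$ of $G$ with $f(x),f(y)>0$. The weight of $f$ is $\sum_{x\in V(G)}f(x)$. The broadcast independence number $\alpha_b(G)$ is the maximum weight of an independent broadcast on $G$, and an independent broadcast on $G$ of weight $\alpha_b(G)$ is called optimal. Strips. For a positive integer $m$, a graph $H$ is an $m$-strip with partition $(B_0,\ldots,B_m)$ if $V(H)$ can be partitioned into $m+1$ nonempty cliques $B_0,\ldots,B_m$ such that: $B_0$ contains a unique vertex $x$; all vertices in $B_i$ have distance $i$ in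 $H$ from $x$; and $B_i$ is completely joined to $B_{i+1}$ (every vertex of $B_i$ is adjacent to every vertex of $B_{i+1}$) for every even index $i$ in $[m-1]_0$. The class $\mathcal{G}_2$. For a positive integer $k$, $\mathcal{G}_2(k)$ is the class of all connected graphs that arise from the disjoint union of two $(2k+1)$-strips $H_1$ with partition $(B_0^1,\ldots,B_{2k+1}^1)$ and $H_2$ with partition $(B_0^2,\ldots,B_{2k+1}^2)$ by adding some edges between $B_{2k+1}^1$ and $B_{2k+1}^2$. Let $\mathcal{G}_2=\bigcup_{k\geq 1}\mathcal{G}_2(k)$. The class $\mathcal{G}_0$. For positive integers $k$ and $\ell$ with $\ell\geq 2$, $\mathcal{G}_0(k,\ell)$ is the class of all graphs that arise from the disjoint union of $\ell$ $2k$-strips $H_1,\ldots,H_\ell$, where $H_i$ has partition $(B_0^i,\ldots,B_{2k}^i)$ for $i$ in $[\ell]$, and a possibly empty set $R$ of vertices, by adding all possible edges within $R\cup\bigcup_{i=1}^{\ell}B_{2k}^i$. Let $\mathcal{G}_0=\bigcup_{k\geq 1}\bigcup_{\ell\geq 2}\mathcal{G}_0(k,\ell)$.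
   Formalization: The class G_2 is taken as the union of G_2(k) over all k ≥ 0 instead of k ≥ 1; with k ≥ 1 the equality characterization fails, e.g. for the path P_4 (diameter 3, α = 2, α_b = 4, f_max = 2), which attains equality but lies in neither class. *)

theory Defs
  imports "Graph_Theory.Graph_Theory" "HOL-Library.Extended_Nat" "HOL-Library.Disjoint_Sets"
begin

text \<open>
  A finite simple undirected graph is a \<open>pair_graph\<close>: finite, loop-free and symmetric, the edge
  \<open>uv\<close> being represented by the two arcs \<open>(u, v)\<close> and \<open>(v, u)\<close>. Connectedness is the library's
  \<open>Digraph_Component.connected\<close>, which includes having at least one vertex.
\<close>

subsection \<open>Distances and independent sets\<close>

text \<open>The infimum over the empty set is \<open>\<infinity>\<close>, so vertices in different components are at
  distance \<open>\<infinity>\<close>.\<close>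

definition graph_dist :: "'a pair_pre_digraph \<Rightarrow> 'a \<Rightarrow> 'a \<Rightarrow> enat" where
  "graph_dist G u v = (INF p \<in> {p. pre_digraph.awalk (with_proj G) u p v}. enat (length p))"

definition eccentricity :: "'a pair_pre_digraph \<Rightarrow> 'a \<Rightarrow> enat" where
  "eccentricity G x = (SUP y \<in> pverts G. graph_dist G x y)"

definition graph_diameter :: "'a pair_pre_digraph \<Rightarrow> enat" where
  "graph_diameter G = (SUP x \<in> pverts G. eccentricity G x)"

definition independent_set :: "'a pair_pre_digraph \<Rightarrow> 'a set \<Rightarrow> bool" where
  "independent_set G S \<longleftrightarrow> S \<subseteq> pverts G \<and> (\<forall>u\<in>S. \<forall>v\<in>S. u \<noteq> v \<longrightarrow> (u, v) \<notin> parcs G)"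

definition independence_number :: "'a pair_pre_digraph \<Rightarrow> nat" where
  "independence_number G = Max (card ` {S. independent_set G S})"

definition is_clique :: "'a pair_pre_digraph \<Rightarrow> 'a set \<Rightarrow> bool" where
  "is_clique G S \<longleftrightarrow> S \<subseteq> pverts G \<and> (\<forall>u\<in>S. \<forall>v\<in>S. u \<noteq> v \<longrightarrow> (u, v) \<in> parcs G)"

subsection \<open>Independent broadcasts\<close>

text \<open>A broadcast is a total function on the vertex type; its values outside \<open>pverts G\<close> are
  irrelevant.\<close>

definition independent_broadcast :: "'a pair_pre_digraph \<Rightarrow> ('a \<Rightarrow> nat) \<Rightarrow> bool" where
  "independent_broadcast G f \<longleftrightarrow>
     (\<forall>x\<in>pverts G. enat (f x) \<le> eccentricity G x) \<and>
     (\<forall>x\<in>pverts G. \<forall>y\<in>pverts G. x \<noteq> y \<and> f x > 0 \<and> f y > 0 \<longrightarrow>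
        graph_dist G x y > enat (max (f x) (f y)))"

definition broadcast_weight :: "'a pair_pre_digraph \<Rightarrow> ('a \<Rightarrow> nat) \<Rightarrow> nat" where
  "broadcast_weight G f = (\<Sum>x\<in>pverts G. f x)"

definition broadcast_independence_number :: "'a pair_pre_digraph \<Rightarrow> nat" where
  "broadcast_independence_number G = Max (broadcast_weight G ` {f. independent_broadcast G f})"

definition optimal_broadcast :: "'a pair_pre_digraph \<Rightarrow> ('a \<Rightarrow> nat) \<Rightarrow> bool" where
  "optimal_broadcast G f \<longleftrightarrow>
     independent_broadcast G f \<and> broadcast_weight G f = broadcast_independence_number G"

subsection \<open>Strips and the extremal classes\<close>

definition strip :: "nat \<Rightarrow> 'a pair_pre_digraph \<Rightarrow> (nat \<Rightarrow> 'a set) \<Rightarrow> bool" where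
  "strip m H B \<longleftrightarrow>
     m > 0 \<and> pair_graph H \<and>
     pverts H = (\<Union>i\<in>{0..m}. B i) \<and> disjoint_family_on B {0..m} \<and>
     (\<forall>i\<in>{0..m}. B i \<noteq> {} \<and> is_clique H (B i)) \<and>
     (\<exists>x. B 0 = {x} \<and> (\<forall>i\<in>{0..m}. \<forall>y\<in>B i. graph_dist H x y = enat i)) \<and>
     (\<forall>i\<in>{0..m-1}. even i \<longrightarrow> (\<forall>u\<in>B i. \<forall>v\<in>B (Suc i). (u, v) \<in> parcs H))"

text \<open>\<open>F\<close> is the set of added edges, each written with its end in \<open>B1 (2 * k + 1)\<close> first.\<close>

definition class_G2_at :: "nat \<Rightarrow> 'a pair_pre_digraph set" where
  "class_G2_at k =
     {G. pair_graph G \<and> connected (with_proj G) \<and>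
         (\<exists>H1 B1 H2 B2 F.
            strip (2 * k + 1) H1 B1 \<and> strip (2 * k + 1) H2 B2 \<and>
            pverts H1 \<inter> pverts H2 = {} \<and>
            F \<subseteq> B1 (2 * k + 1) \<times> B2 (2 * k + 1) \<and>
            pverts G = pverts H1 \<union> pverts H2 \<and>
            parcs G = parcs H1 \<union> parcs H2 \<union> F \<union> F\<inverse>)}"

text \<open>
  The source lets \<open>k\<close> range over the positive integers here. With that range the characterization
  of equality is false: the path \<open>P\<^sub>4\<close> (two 1-strips joined by an edge) has diameter 3, independence
  number 2 and the optimal independent broadcast \<open>(2, 0, 0, 2)\<close>, so the bound holds with
  equality, but \<open>P\<^sub>4\<close> has too few vertices for the remaining classes. The members
  of \<open>class_G2_at 0\<close> are exactly the connected graphs of diameter 3 and independence number 2, and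
  all of them attain equality; hence \<open>k = 0\<close> is included.
\<close>

definition class_G2 :: "'a pair_pre_digraph set" where
  "class_G2 = (\<Union>k\<in>{0..}. class_G2_at k)"

definition class_G0_at :: "nat \<Rightarrow> nat \<Rightarrow> 'a pair_pre_digraph set" where
  "class_G0_at k l =
     {G. pair_graph G \<and>
         (\<exists>H B R.
            (\<forall>i\<in>{1..l}. strip (2 * k) (H i) (B i)) \<and>
            disjoint_family_on (\<lambda>i. pverts (H i)) {1..l} \<and>
            finite R \<and> R \<inter> (\<Union>i\<in>{1..l}. pverts (H i)) = {} \<and>
            pverts G = (\<Union>i\<in>{1..l}. pverts (H i)) \<union> R \<and>
            parcs G = (\<Union>i\<in>{1..l}. parcs (H i)) \<union>
              {(u, v). u \<noteq> v \<and> u \<in> R \<union> (\<Union>i\<in>{1..l}. B i (2 * k)) \<and>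
                                v \<in> R \<union> (\<Union>i\<in>{1..l}. B i (2 * k))})}"

definition class_G0 :: "'a pair_pre_digraph set" where
  "class_G0 = (\<Union>k\<in>{1..}. \<Union>l\<in>{2..}. class_G0_at k l)"

end

theory Submission
  imports Defs
begin

text \<open>
  Let \<open>f\<close> be optimal. Comparing with the broadcasts that are constant on a maximum independent
  set or on a diametral pair shows that \<open>f\<close> has at least two positive values. The even vertices of
  a geodesic then give \<open>fmax + 2 \<le> 2 \<alpha>\<close>, so the minimum in the bound equals 1 and the claim is
  \<open>\<alpha>\<^sub>b \<le> 4 \<alpha> - 4\<close>.

  Around every \<open>x\<close> with \<open>f x > 0\<close> take the vertices at even distance less than \<open>f x / 2\<close>
  from \<open>x\<close> on a long geodesic starting in \<open>x\<close>, that is \<open>K x = \<lceil>f x / 4\<rceil>\<close> vertices.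
  Their union is independent. If \<open>f z mod 4 \<in> {0, 3}\<close> for some \<open>z\<close>, one more vertex fits
  around \<open>z\<close>; otherwise \<open>4 K x \<ge> f x + 2\<close> for all \<open>x\<close>. In both cases the bound follows.
  Equality forces \<open>f = 4 K\<close> in the first case, and in the second case exactly two positive
  values, both \<open>4 K - 2\<close>. As no independent set exceeds the constructed one, every nonadjacent
  pair in a sphere, or in consecutive spheres to be joined, is excluded by exchanging levels, so
  that the balls around the positive vertices are strips.

  Conversely, a potential function shows that the centres of the strips are far apart, and
  pairing consecutive levels covers the graph by few cliques, which bounds \<open>\<alpha>\<close> from above.
\<close>

subsection \<open>Distances\<close>

context pair_wf_digraph
begin

lemma graph_dist_le_awalk: "awalk u p v \<Longrightarrow> graph_dist G u v \<le> enat (length p)"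
  unfolding graph_dist_def by (intro INF_lower) simp

text \<open>A finite infimum excludes the empty set of walks, and every nonempty set of
  \<open>enat\<close> values attains its infimum by well-ordering.\<close>

lemma graph_dist_awalk:
  assumes "graph_dist G u v = enat n"
  obtains p where "awalk u p v" "length p = n"
proof -
  let ?L = "(\<lambda>p. enat (length p)) ` {p. awalk u p v}"
  have eq: "Inf ?L = enat n" using assms unfolding graph_dist_def by simp
  then have "?L \<noteq> {}" by (metis Inf_enat_def enat.distinct(2))
  then have "Inf ?L \<in> ?L"
    by (metis (no_types, lifting) Inf_enat_def LeastI all_not_in_conv)
  then show ?thesis using that eq by (auto simp: image_iff)
qed

lemma graph_dist_self: "u \<in> pverts G \<Longrightarrow> graph_dist G u u = 0"
  using graph_dist_le_awalk[of u "[]" u] by (simp add: awalk_Nil_iff zero_enat_def[symmetric])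

lemma graph_dist_arc_le:
  assumes "(v, w) \<in> parcs G"
  shows "graph_dist G u w \<le> graph_dist G u v + 1"
proof (cases "graph_dist G u v")
  case (enat n)
  then obtain p where p: "awalk u p v" "length p = n" by (rule graph_dist_awalk)
  have "awalk v [(v, w)] w" using assms by (auto simp: awalk_simps dest: wellformed')
  with p have "awalk u (p @ [(v, w)]) w" by auto
  from graph_dist_le_awalk[OF this] show ?thesis using enat p(2) by (simp add: one_enat_def)
qed simp

text \<open>The potential \<open>h\<close> rises by at most one per arc, hence by at most the length
  of any walk. This yields lower bounds on distances without examining shortest walks.\<close>

lemma graph_dist_potential:
  assumes step: "\<And>a b. (a, b) \<in> parcs G \<Longrightarrow> h b \<le> Suc (h a)"
  shows "enat (h v) \<le> enat (h u) + graph_dist G u v"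
proof (cases "graph_dist G u v")
  case (enat n)
  then obtain p where p: "awalk u p v" "length p = n" by (rule graph_dist_awalk)
  have "h v \<le> h u + length p" using p(1)
  proof (induction p arbitrary: u)
    case Nil
    then show ?case by (simp add: awalk_Nil_iff)
  next
    case (Cons e es)
    then have "e \<in> parcs G" "fst e = u" "awalk (snd e) es v" by (auto simp: awalk_Cons_iff)
    with Cons.IH[of "snd e"] step[of u "snd e"] show ?case by (cases e) force
  qed
  with enat p(2) show ?thesis by simp
qed simp

end

section \<open>Natural-number distances in a connected graph\<close>

locale connected_pair_graph = pair_graph +
  assumes conn: "connected (with_proj G)"
begin

lemma graph_dist_finite:
  assumes "u \<in> pverts G" "v \<in> pverts G"
  shows "graph_dist G u v \<noteq> \<infinity>"
proof -
  have "strongly_connected (with_proj G)"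
    using symmetric_connected_imp_strongly_connected conn pair_sym_arcs by blast
  then have "u \<rightarrow>\<^sup>*\<^bsub>with_proj G\<^esub> v" using assms by auto
  then obtain p where "awalk u p v" by (auto simp: reachable_awalk)
  from graph_dist_le_awalk[OF this] show ?thesis by (cases "graph_dist G u v") auto
qed

text \<open>Connectedness makes all distances between vertices finite, so \<open>the_enat\<close>
  loses nothing there and arithmetic can be done in \<open>nat\<close>.\<close>

definition vdist :: "'a \<Rightarrow> 'a \<Rightarrow> nat" where
  "vdist u v = the_enat (graph_dist G u v)"

lemma graph_dist_eq: "u \<in> pverts G \<Longrightarrow> v \<in> pverts G \<Longrightarrow> graph_dist G u v = enat (vdist u v)"
  unfolding vdist_def using graph_dist_finite by (metis enat.exhaust the_enat.simps)

lemma vdist_awalk: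
  assumes "u \<in> pverts G" "v \<in> pverts G"
  obtains p where "awalk u p v" "length p = vdist u v"
  using graph_dist_awalk[OF graph_dist_eq[OF assms]] by blast

lemma vdist_le_awalk: "awalk u p v \<Longrightarrow> vdist u v \<le> length p"
  using graph_dist_le_awalk[of u p v] graph_dist_eq[of u v] awalk_hd_in_verts[of u p v]
    awalk_last_in_verts[of u p v] by simp

lemma vdist_self [simp]: "u \<in> pverts G \<Longrightarrow> vdist u u = 0"
  using graph_dist_self by (simp add: vdist_def zero_enat_def)

lemma vdist_sym: 
  assumes "u \<in> pverts G" "v \<in> pverts G"
  shows "vdist u v = vdist v u"
proof -
  have "vdist b a \<le> vdist a b" if ab: "a \<in> pverts G" "b \<in> pverts G" for a b
  proof -
    obtain p where p: "awalk a p b" "length p = vdist a b" using vdist_awalk[OF ab] by blast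
    have "length (rev_path p) = length p" by (induction p) auto
    with p vdist_le_awalk[of b "rev_path p" a] show ?thesis by simp
  qed
  then show ?thesis using assms by (simp add: antisym)
qed

lemma vdist_triangle:
  assumes "u \<in> pverts G" "v \<in> pverts G" "w \<in> pverts G"
  shows "vdist u w \<le> vdist u v + vdist v w"
proof -
  obtain p where p: "awalk u p v" "length p = vdist u v" using vdist_awalk assms by metis
  obtain q where q: "awalk v q w" "length q = vdist v w" using vdist_awalk assms by metis
  have "awalk u (p @ q) w" using p(1) q(1) by auto
  from vdist_le_awalk[OF this] p q show ?thesis by simp
qed

lemma vdist_arc_le:
  assumes "u \<in> pverts G" "(v, w) \<in> parcs G"
  shows "vdist u w \<le> Suc (vdist u v)"
  using graph_dist_arc_le[OF assms(2), of u] assms wellformed'[OF assms(2)]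
  by (simp add: graph_dist_eq one_enat_def)

lemma vdist_arc_le': "u \<in> pverts G \<Longrightarrow> (v, w) \<in> parcs G \<Longrightarrow> vdist u v \<le> Suc (vdist u w)"
  by (rule vdist_arc_le) (auto intro: arcs_symmetric)

lemma vdist_Suc_pred:
  assumes "u \<in> pverts G" "v \<in> pverts G" "vdist u v = Suc n"
  obtains w where "(w, v) \<in> parcs G" "vdist u w = n"
proof -
  obtain p where p: "awalk u p v" "length p = Suc n" using vdist_awalk assms by metis
  then obtain q e where pq: "p = q @ [e]" by (cases p rule: rev_cases) auto
  then obtain w where w: "awalk u q w" "awalk w [e] v" using p(1) by auto
  then have arc: "(w, v) \<in> parcs G" by (cases e) (auto simp: awalk_simps)
  have "vdist u w \<le> n" using vdist_le_awalk[OF w(1)] p(2) pq by simp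
  moreover have "Suc n \<le> Suc (vdist u w)" using vdist_arc_le[OF assms(1) arc] assms(3) by simp
  ultimately show ?thesis using that[OF arc] by simp
qed

text \<open>Repeatedly passing to the last-but-one vertex of a shortest walk lowers the distance one
  by one. Vertices obtained for different \<open>n\<close> need not lie on a common geodesic; their
  distances from \<open>u\<close> alone suffice to keep them apart.\<close>

lemma vdist_level:
  assumes "u \<in> pverts G" "v \<in> pverts G" "n \<le> vdist u v"
  obtains w where "w \<in> pverts G" "vdist u w = n"
proof -
  have "\<exists>w\<in>pverts G. vdist u w = n" using assms(2,3)
  proof (induction "vdist u v - n" arbitrary: v)
    case 0
    then show ?case by force
  next
    case (Suc m)
    then obtain j where j: "vdist u v = Suc j" "j - n = m" "n \<le> j"
      by (cases "vdist u v") auto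
    with Suc.prems obtain w where "(w, v) \<in> parcs G" "vdist u w = j"
      using vdist_Suc_pred assms(1) by metis
    with Suc.hyps(1)[of w] j show ?case by (auto dest: wellformed')
  qed
  then show ?thesis using that by blast
qed

lemma vdist_eq_0: "u \<in> pverts G \<Longrightarrow> v \<in> pverts G \<Longrightarrow> vdist u v = 0 \<longleftrightarrow> u = v"
  by (rule iffI, rule vdist_awalk[of u v]) (auto simp: awalk_Nil_iff)

lemma vdist_le_1:
  assumes "u \<in> pverts G" "v \<in> pverts G" "vdist u v \<le> 1" "u \<noteq> v"
  shows "(u, v) \<in> parcs G"
proof -
  have "vdist u v = Suc 0" using assms vdist_eq_0[of u v] by auto
  then obtain w where w: "(w, v) \<in> parcs G" "vdist u w = 0" using vdist_Suc_pred assms by metis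
  then show ?thesis using vdist_eq_0[of u w] assms(1) by (auto dest: wellformed')
qed

lemma vdist_arc: "(u, v) \<in> parcs G \<Longrightarrow> vdist u v \<le> 1"
  using vdist_arc_le[of u u v] by (auto dest: wellformed')

lemma le_eccentricity_iff:
  assumes "x \<in> pverts G"
  shows "enat n \<le> eccentricity G x \<longleftrightarrow> (\<exists>y\<in>pverts G. n \<le> vdist x y)"
proof
  assume L: "enat n \<le> eccentricity G x"
  show "\<exists>y\<in>pverts G. n \<le> vdist x y"
  proof (rule ccontr)
    assume "\<not> ?thesis"
    then have *: "vdist x y < n" if "y \<in> pverts G" for y using that by auto
    \<comment> \<open>The vertex \<open>x\<close> itself is at distance 0, so \<open>n - 1\<close>
      below is not truncated.\<close>
    then have n: "0 < n" using assms by force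
    have "eccentricity G x \<le> enat (n - 1)" unfolding eccentricity_def
      using * assms by (intro SUP_least) (force simp: graph_dist_eq)
    with L have "enat n \<le> enat (n - 1)" by (rule order.trans)
    with n show False by simp
  qed
next
  assume "\<exists>y\<in>pverts G. n \<le> vdist x y"
  then obtain y where y: "y \<in> pverts G" "n \<le> vdist x y" by blast
  then have "enat n \<le> graph_dist G x y" using assms by (simp add: graph_dist_eq)
  then show "enat n \<le> eccentricity G x"
    unfolding eccentricity_def by (rule SUP_upper2[OF y(1)])
qed

lemma le_graph_diameter_iff:
  "enat (Suc n) \<le> graph_diameter G \<longleftrightarrow> (\<exists>x\<in>pverts G. \<exists>y\<in>pverts G. Suc n \<le> vdist x y)"
proof
  assume L: "enat (Suc n) \<le> graph_diameter G"
  show "\<exists>x\<in>pverts G. \<exists>y\<in>pverts G. Suc n \<le> vdist x y"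
  proof (rule ccontr)
    assume "\<not> ?thesis"
    then have *: "vdist x y \<le> n" if "x \<in> pverts G" "y \<in> pverts G" for x y
      using that by (auto simp: not_less_eq_eq)
    then have "graph_diameter G \<le> enat n" unfolding graph_diameter_def eccentricity_def
      by (intro SUP_least) (auto simp: graph_dist_eq)
    with L show False by (meson Suc_n_not_le_n enat_ord_simps(1) order.trans)
  qed
next
  assume "\<exists>x\<in>pverts G. \<exists>y\<in>pverts G. Suc n \<le> vdist x y"
  then obtain x where x: "x \<in> pverts G" "enat (Suc n) \<le> eccentricity G x"
    using le_eccentricity_iff by blast
  then show "enat (Suc n) \<le> graph_diameter G"
    unfolding graph_diameter_def by (rule SUP_upper2)
qed

section \<open>Broadcasts and independent sets in terms of \<open>vdist\<close>\<close>

lemma independent_broadcast_iff: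
  "independent_broadcast G f \<longleftrightarrow>
     (\<forall>x\<in>pverts G. \<exists>y\<in>pverts G. f x \<le> vdist x y) \<and>
     (\<forall>x\<in>pverts G. \<forall>y\<in>pverts G. x \<noteq> y \<and> f x > 0 \<and> f y > 0 \<longrightarrow> max (f x) (f y) < vdist x y)"
  unfolding independent_broadcast_def by (simp add: le_eccentricity_iff graph_dist_eq)

lemma finite_independent_sets: "finite {S. independent_set G S}"
  by (rule finite_subset[of _ "Pow (pverts G)"])
    (auto simp: independent_set_def pair_finite_verts)

lemma card_le_independence_number: "independent_set G S \<Longrightarrow> card S \<le> independence_number G"
  unfolding independence_number_def using finite_independent_sets by (intro Max_ge) auto

lemma maximum_independent_set:
  obtains S where "independent_set G S" "card S = independence_number G"
proof -
  have "{} \<in> {S. independent_set G S}" by (simp add: independent_set_def)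
  then have "independence_number G \<in> card ` {S. independent_set G S}"
    unfolding independence_number_def using finite_independent_sets by (intro Max_in) auto
  then show ?thesis using that by auto
qed

text \<open>Values outside the vertex set are free, so there may be infinitely many broadcasts. The
  finiteness that \<open>Max\<close> requires comes from the weights, which are bounded by
  \<open>D\<close>, the sum of all eccentricities.\<close>

lemma weight_le_broadcast_independence_number:
  assumes "independent_broadcast G f"
  shows "broadcast_weight G f \<le> broadcast_independence_number G"
proof -
  define D where "D = (\<Sum>x\<in>pverts G. Max (vdist x ` pverts G))"
  have "broadcast_weight G g \<le> D" if "independent_broadcast G g" for g
    unfolding D_def broadcast_weight_def
  proof (rule sum_mono)
    fix x assume "x \<in> pverts G"
    then obtain y where "y \<in> pverts G" "g x \<le> vdist x y"
      using \<open>independent_broadcast G g\<close> by (auto simp: independent_broadcast_iff)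
    then show "g x \<le> Max (vdist x ` pverts G)"
      by (intro order.trans[OF _ Max_ge]) (auto simp: pair_finite_verts)
  qed
  then have "finite (broadcast_weight G ` {f. independent_broadcast G f})"
    by (intro finite_subset[OF _ finite_atMost[of D]]) blast
  then show ?thesis
    unfolding broadcast_independence_number_def by (rule Max_ge) (use assms in blast)
qed

text \<open>Pigeonhole: sending each vertex of a maximum independent set to a clique containing it
  is injective.\<close>

lemma independence_number_le_clique_cover:
  assumes "finite I"
    and "\<And>v. v \<in> pverts G \<Longrightarrow> \<exists>i\<in>I. v \<in> C i"
    and "\<And>i u v. i \<in> I \<Longrightarrow> u \<in> C i \<Longrightarrow> v \<in> C i \<Longrightarrow> u \<noteq> v \<Longrightarrow> (u, v) \<in> parcs G"
  shows "independence_number G \<le> card I"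
proof -
  obtain S where S: "independent_set G S" "card S = independence_number G"
    by (rule maximum_independent_set)
  have "\<exists>c. \<forall>v\<in>S. c v \<in> I \<and> v \<in> C (c v)"
    using S(1) assms(2) unfolding independent_set_def by (intro bchoice) blast
  then obtain c where c: "c v \<in> I" "v \<in> C (c v)" if "v \<in> S" for v by blast
  have "inj_on c S"
  proof (rule inj_onI)
    fix u v assume uv: "u \<in> S" "v \<in> S" "c u = c v"
    show "u = v"
    proof (rule ccontr)
      assume "u \<noteq> v"
      then have "(u, v) \<in> parcs G" using assms(3)[OF c(1) c(2)] c(2)[of v] uv by simp
      with S(1) uv \<open>u \<noteq> v\<close> show False by (auto simp: independent_set_def)
    qed
  qed
  moreover have "c ` S \<subseteq> I" using c(1) by blast
  ultimately have "card S \<le> card I" using assms(1) by (rule card_inj_on_le)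
  then show ?thesis using S(2) by simp
qed


subsection \<open>Independent sets from geodesics\<close>

text \<open>The basic construction: every centre \<open>x\<close> contributes vertices at distances
  \<open>0, 2, ..., 2 * h x\<close>, which exist by \<open>far\<close>. The conditions
  \<open>sep\<close> and \<open>sepY\<close> keep the families at distance at least 2 from each
  other and from the additional set \<open>Y\<close>.\<close>

lemma card_geodesic_sum_le_independence_number:
  assumes X: "finite X" "X \<subseteq> pverts G"
    and far: "\<And>x. x \<in> X \<Longrightarrow> \<exists>y\<in>pverts G. 2 * h x \<le> vdist x y"
    and sep: "\<And>x y. x \<in> X \<Longrightarrow> y \<in> X \<Longrightarrow> x \<noteq> y \<Longrightarrow> 2 * h x + 2 * h y + 2 \<le> vdist x y"
    and Y: "independent_set G Y"
    and sepY: "\<And>x y. x \<in> X \<Longrightarrow> y \<in> Y \<Longrightarrow> 2 * h x + 2 \<le> vdist x y"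
  shows "card Y + (\<Sum>x\<in>X. h x + 1) \<le> independence_number G"
proof -
  have "\<forall>x\<in>X. \<forall>t\<le>h x. \<exists>w. w \<in> pverts G \<and> vdist x w = 2 * t"
  proof (intro ballI allI impI)
    fix x t assume xt: "x \<in> X" "t \<le> h x"
    then obtain y where y: "y \<in> pverts G" "2 * h x \<le> vdist x y" using far by blast
    have "2 * t \<le> vdist x y" using xt(2) y(2) by simp
    with xt(1) X(2) y(1) show "\<exists>w. w \<in> pverts G \<and> vdist x w = 2 * t"
      by (metis subsetD vdist_level)
  qed
  then obtain v where v: "v x t \<in> pverts G" "vdist x (v x t) = 2 * t" if "x \<in> X" "t \<le> h x" for x t
    by metis
  define P where "P = (SIGMA x:X. {..h x})"
  define V where "V = (\<lambda>(x, t). v x t)"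
  \<comment> \<open>For one centre the levels are distinct even numbers; for two centres the
    triangle inequality leaves at least 2 of the distance in \<open>sep\<close>.\<close>
  have gap: "2 \<le> vdist (V p) (V q)" if pq: "p \<in> P" "q \<in> P" "p \<noteq> q" for p q
  proof -
    obtain x s where p: "p = (x, s)" "x \<in> X" "s \<le> h x" using pq(1) by (auto simp: P_def)
    obtain y t where q: "q = (y, t)" "y \<in> X" "t \<le> h y" using pq(2) by (auto simp: P_def)
    note a = v[OF p(2,3)] and b = v[OF q(2,3)]
    have xy: "x \<in> pverts G" "y \<in> pverts G" using p(2) q(2) X(2) by auto
    show ?thesis
    proof (cases "x = y")
      case True
      have "2 * t \<le> 2 * s + vdist (V p) (V q)"
        using vdist_triangle[OF xy(1) a(1) b(1)] a(2) b(2) True p(1) q(1) by (simp add: V_def)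
      moreover have "2 * s \<le> 2 * t + vdist (V p) (V q)"
        using vdist_triangle[OF xy(1) b(1) a(1)] a(2) b(2) True p(1) q(1) vdist_sym[OF a(1) b(1)]
        by (simp add: V_def)
      moreover have "s \<noteq> t" using True p(1) q(1) pq(3) by simp
      ultimately show ?thesis by linarith
    next
      case False
      have "vdist x y \<le> vdist x (v x s) + (vdist (v x s) (v y t) + vdist (v y t) y)"
        using vdist_triangle[OF xy(1) a(1) xy(2)] vdist_triangle[OF a(1) b(1) xy(2)] by linarith
      moreover have "vdist (v y t) y = 2 * t" using vdist_sym[OF b(1) xy(2)] b(2) by simp
      ultimately show ?thesis using sep[OF p(2) q(2) False] a(2) p q by (simp add: V_def)
    qed
  qed
  have gapY: "2 \<le> vdist (V p) y" if py: "p \<in> P" "y \<in> Y" for p y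
  proof -
    obtain x s where p: "p = (x, s)" "x \<in> X" "s \<le> h x" using py(1) by (auto simp: P_def)
    note a = v[OF p(2,3)]
    have xy: "x \<in> pverts G" "y \<in> pverts G" using p(2) py(2) X(2) Y by (auto simp: independent_set_def)
    show ?thesis using vdist_triangle[OF xy(1) a(1) xy(2)] sepY[OF p(2) py(2)] a(2) p
      by (simp add: V_def)
  qed
  have VP: "V p \<in> pverts G" if "p \<in> P" for p using that v(1) by (auto simp: P_def V_def)
  have nonarc: "(a, b) \<notin> parcs G \<and> (b, a) \<notin> parcs G \<and> a \<noteq> b"
    if "2 \<le> vdist a b" "a \<in> pverts G" "b \<in> pverts G" for a b
    using vdist_arc[of a b] vdist_arc[of b a] vdist_sym[OF that(2,3)] that by auto
  have YV: "Y \<subseteq> pverts G" using Y by (simp add: independent_set_def)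
  have ind: "independent_set G (Y \<union> V ` P)"
    unfolding independent_set_def
  proof (intro conjI ballI impI)
    show "Y \<union> V ` P \<subseteq> pverts G" using YV VP by auto
    fix a b assume ab: "a \<in> Y \<union> V ` P" "b \<in> Y \<union> V ` P" "a \<noteq> b"
    show "(a, b) \<notin> parcs G"
    proof (cases "a \<in> Y \<and> b \<in> Y")
      case True
      then show ?thesis using Y ab(3) by (auto simp: independent_set_def)
    next
      case False
      then consider p q where "p \<in> P" "q \<in> P" "a = V p" "b = V q"
        | p where "p \<in> P" "a = V p" "b \<in> Y" | q where "q \<in> P" "b = V q" "a \<in> Y"
        using ab by blast
      then show ?thesis
      proof cases
        case 1
        then show ?thesis using gap[of p q] nonarc[of a b] VP ab(3) by metis
      next
        case 2
        then show ?thesis using gapY[of p b] nonarc[of a b] VP YV by blast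
      next
        case 3
        then show ?thesis using gapY[of q a] nonarc[of b a] VP YV by blast
      qed
    qed
  qed
  have "Y \<inter> V ` P = {}" using gapY nonarc VP YV by fastforce
  moreover have "inj_on V P"
  proof (rule inj_onI)
    fix p q assume "p \<in> P" "q \<in> P" "V p = V q"
    then show "p = q" using gap[of p q] nonarc[of "V p" "V q"] VP by blast
  qed
  moreover have "finite Y" using YV pair_finite_verts by (rule finite_subset)
  moreover have "finite P" using X(1) by (simp add: P_def)
  ultimately have "card (Y \<union> V ` P) = card Y + card P"
    by (simp add: card_Un_disjoint card_image)
  also have "card P = (\<Sum>x\<in>X. h x + 1)" using X(1) by (simp add: P_def)
  finally show ?thesis using card_le_independence_number[OF ind] by simp
qed

text \<open>The levels \<open>vdist x u - 2, vdist x u - 4, \<dots>\<close> below and \<open>vdist x w + 2, \<dots>\<close> above the pair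
  are filled from a geodesic.\<close>

lemma independent_pair_with_levels:
  assumes x: "x \<in> pverts G" and far: "z \<in> pverts G" "m \<le> vdist x z"
    and uw: "u \<in> pverts G" "w \<in> pverts G" "u \<noteq> w" "(u, w) \<notin> parcs G"
    and lev: "vdist x u \<le> vdist x w" "vdist x w \<le> m"
  obtains S where "independent_set G S" "\<And>s. s \<in> S \<Longrightarrow> vdist x s \<le> m"
    "card S = 2 + vdist x u div 2 + (m - vdist x w) div 2"
proof -
  let ?i = "vdist x u" and ?j = "vdist x w"
  have "\<forall>n\<le>m. \<exists>a. a \<in> pverts G \<and> vdist x a = n"
    using vdist_level[OF x far(1)] far(2) by (metis order.trans)
  then obtain v where v: "v n \<in> pverts G" "vdist x (v n) = n" if "n \<le> m" for n by metis
  define D1 where "D1 = (\<lambda>t. ?i - 2 * t) ` {1..?i div 2}"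
  define D2 where "D2 = (\<lambda>t. ?j + 2 * t) ` {1..(m - ?j) div 2}"
  have D1: "n + 2 \<le> ?i" "even (?i - n)" if "n \<in> D1" for n using that by (auto simp: D1_def)
  have D2: "?j + 2 \<le> n" "n \<le> m" "even (n - ?j)" if "n \<in> D2" for n
    using that by (auto simp: D2_def)
  have c1: "card D1 = ?i div 2" unfolding D1_def
    by (subst card_image) (auto intro!: inj_onI)
  have c2: "card D2 = (m - ?j) div 2" unfolding D2_def
    by (subst card_image) (auto intro!: inj_onI)
  define D where "D = D1 \<union> D2"
  have Dm: "n \<le> m" if "n \<in> D" for n using that D1[of n] D2[of n] lev by (auto simp: D_def)
  \<comment> \<open>Parity is constant on \<open>D1\<close> and on \<open>D2\<close>, and the pair
    \<open>u\<close>, \<open>w\<close> lies between the two ranges of levels.\<close>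
  have gap: "a + 2 \<le> b" if "a \<in> D" "b \<in> D" "a < b" for a b
  proof -
    have "even (b - a)" if "a \<in> D1" "b \<in> D1" for a b using D1[OF that(1)] D1[OF that(2)] by presburger
    moreover have "even (b - a)" if "a \<in> D2" "b \<in> D2" for a b
      using D2[OF that(1)] D2[OF that(2)] by presburger
    moreover have "a + 2 \<le> b" if "a \<in> D1" "b \<in> D2" for a b
      using D1(1)[OF that(1)] D2(1)[OF that(2)] lev by linarith
    ultimately have "even (b - a) \<or> a + 2 \<le> b \<or> b + 2 \<le> a"
      using \<open>a \<in> D\<close> \<open>b \<in> D\<close> unfolding D_def by blast
    then show ?thesis using \<open>a < b\<close> by presburger
  qed
  have gapu: "a + 2 \<le> ?i \<or> ?j + 2 \<le> a" if "a \<in> D" for a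
    using that D1[of a] D2[of a] by (auto simp: D_def)
  define S where "S = {u, w} \<union> v ` D"
  have SV: "S \<subseteq> pverts G" using uw v Dm by (auto simp: S_def)
  have levS: "vdist x (v n) = n" if "n \<in> D" for n using v(2) Dm that by blast
  have nonarc: "(a, b) \<notin> parcs G" if "vdist x a + 2 \<le> vdist x b \<or> vdist x b + 2 \<le> vdist x a" for a b
    using that vdist_arc_le[OF x, of a b] vdist_arc_le'[OF x, of a b] by linarith
  have "independent_set G S" unfolding independent_set_def
  proof (intro conjI ballI impI SV)
    fix a b assume ab: "a \<in> S" "b \<in> S" "a \<noteq> b"
    then consider "a \<in> {u, w}" "b \<in> {u, w}" | n where "n \<in> D" "a = v n" "b \<in> {u, w}"
      | n where "n \<in> D" "b = v n" "a \<in> {u, w}"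
      | n k where "n \<in> D" "a = v n" "k \<in> D" "b = v k" by (auto simp: S_def)
    then show "(a, b) \<notin> parcs G"
    proof cases
      case 1
      then show ?thesis using uw ab(3) arcs_symmetric[of w u] by auto
    next
      case 2
      then show ?thesis using gapu[of n] levS[of n] lev by (intro nonarc) auto
    next
      case 3
      then show ?thesis using gapu[of n] levS[of n] lev by (intro nonarc) auto
    next
      case 4
      then have "n \<noteq> k" using ab(3) by auto
      then show ?thesis using 4 gap[of n k] gap[of k n] levS by (intro nonarc) (auto simp: neq_iff)
    qed
  qed
  moreover have "vdist x s \<le> m" if "s \<in> S" for s
    using that Dm levS lev by (auto simp: S_def)
  moreover have "card S = 2 + ?i div 2 + (m - ?j) div 2"
  proof -
    have fin: "finite D1" "finite D2" by (auto simp: D1_def D2_def)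
    have "D1 \<inter> D2 = {}" using D1(1) D2(1) lev by fastforce
    then have "card D = ?i div 2 + (m - ?j) div 2"
      using c1 c2 fin by (simp add: D_def card_Un_disjoint)
    moreover have "card (v ` D) = card D" by (metis card_image inj_onI levS)
    moreover have "u \<notin> v ` D" "w \<notin> v ` D" using levS gapu lev by fastforce+
    ultimately show ?thesis using uw(3) fin by (simp add: S_def D_def)
  qed
  ultimately show ?thesis using that by blast
qed

subsection \<open>Recognizing strips\<close>

text \<open>The subgraph induced on the ball of radius \<open>M\<close> around \<open>x\<close>; the
  spheres serve as the partition of the strip.\<close>

definition ball_graph :: "'a \<Rightarrow> nat \<Rightarrow> 'a pair_pre_digraph" where
  "ball_graph x M = \<lparr>pverts = {v \<in> pverts G. vdist x v \<le> M},
     parcs = {(a, b) \<in> parcs G. vdist x a \<le> M \<and> vdist x b \<le> M}\<rparr>"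

definition sphere :: "'a \<Rightarrow> nat \<Rightarrow> 'a set" where
  "sphere x i = {v \<in> pverts G. vdist x v = i}"

lemma ball_graph_simps [simp]:
  "pverts (ball_graph x M) = {v \<in> pverts G. vdist x v \<le> M}"
  "parcs (ball_graph x M) = {(a, b) \<in> parcs G. vdist x a \<le> M \<and> vdist x b \<le> M}"
  by (simp_all add: ball_graph_def)

lemma pair_graph_ball_graph: "pair_graph (ball_graph x M)"
proof unfold_locales
  show "finite (pverts (ball_graph x M))" using pair_finite_verts by simp
  show "finite (parcs (ball_graph x M))"
    by (rule finite_subset[OF _ pair_finite_arcs]) auto
  show "symmetric (with_proj (ball_graph x M))"
    by (auto simp: symmetric_def intro!: symI intro: arcs_symmetric)
qed (auto dest: wellformed' no_loops')

text \<open>Distances to the centre survive in the ball: \<open>vdist x\<close> is a potential on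
  the subgraph, and predecessors on a shortest walk from \<open>x\<close> stay inside the
  ball.\<close>

lemma graph_dist_ball_graph:
  assumes "x \<in> pverts G" "v \<in> pverts G" "vdist x v \<le> M"
  shows "graph_dist (ball_graph x M) x v = enat (vdist x v)"
proof -
  interpret H: pair_graph "ball_graph x M" by (rule pair_graph_ball_graph)
  have "enat (vdist x v) \<le> enat (vdist x x) + graph_dist (ball_graph x M) x v"
    by (rule H.graph_dist_potential) (use vdist_arc_le[OF assms(1)] in auto)
  moreover have "graph_dist (ball_graph x M) x v \<le> enat (vdist x v)"
    using assms(2,3)
  proof (induction "vdist x v" arbitrary: v)
    case 0
    then have "v = x" using vdist_eq_0 assms(1) by metis
    then show ?case using H.graph_dist_self[of x] assms(1) by simp
  next
    case (Suc n)
    then obtain w where w: "(w, v) \<in> parcs G" "vdist x w = n"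
      using vdist_Suc_pred[OF assms(1)] by metis
    with Suc have "graph_dist (ball_graph x M) x w \<le> enat n" by (auto dest: wellformed')
    moreover have "(w, v) \<in> parcs (ball_graph x M)" using w Suc by simp
    ultimately have "graph_dist (ball_graph x M) x v \<le> enat n + 1"
      using H.graph_dist_arc_le by (meson add_right_mono order.trans)
    then show ?case using Suc.hyps(2) by (simp add: one_enat_def)
  qed
  ultimately show ?thesis using assms(1) by (simp add: zero_enat_def[symmetric] antisym)
qed

text \<open>By \<open>small\<close>, no independent set in the ball of radius \<open>M\<close> or
  \<open>M - 1\<close> beats one vertex on every second level. A missing edge within a sphere, or
  between spheres \<open>i\<close> and \<open>i + 1\<close> with \<open>i\<close> even, would allow
  a larger set.\<close>

lemma strip_ball_graph:
  assumes x: "x \<in> pverts G" and M: "0 < M" and far: "z \<in> pverts G" "M \<le> vdist x z"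
    and small: "\<And>S m. m = M - 1 \<or> m = M \<Longrightarrow> independent_set G S \<Longrightarrow>
      (\<And>s. s \<in> S \<Longrightarrow> vdist x s \<le> m) \<Longrightarrow> card S \<le> m div 2 + 1"
  shows "strip M (ball_graph x M) (sphere x)"
proof -
  have adj: "(u, w) \<in> parcs G"
    if uw: "u \<in> pverts G" "w \<in> pverts G" "u \<noteq> w" "vdist x u = i" "vdist x w = j"
      and ij: "i = j \<or> even i \<and> j = Suc i" "j \<le> M" for u w i j
  proof (rule ccontr)
    assume na: "(u, w) \<notin> parcs G"
    \<comment> \<open>With the parity of \<open>j\<close>, filling every second level above
      \<open>j\<close> ends exactly at \<open>m\<close>, so rounding loses nothing. This is why
      \<open>small\<close> speaks of two radii.\<close>
    obtain m where m: "m = M - 1 \<or> m = M" "even m = even j" "j \<le> m"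
    proof (cases "even j = even M")
      case True
      then show ?thesis using that[of M] ij(2) by simp
    next
      case False
      then have "j \<le> M - 1" using ij(2) by (cases "j = M") auto
      moreover have "even (M - 1) = even j" using False M by auto
      ultimately show ?thesis using that[of "M - 1"] by simp
    qed
    have mz: "m \<le> vdist x z" using m(1) far(2) by auto
    have lev: "vdist x u \<le> vdist x w" "vdist x w \<le> m" using uw(4,5) ij(1) m(3) by auto
    obtain S where S: "independent_set G S" "\<And>s. s \<in> S \<Longrightarrow> vdist x s \<le> m"
      "card S = 2 + i div 2 + (m - j) div 2"
      using independent_pair_with_levels[OF x far(1) mz uw(1,2,3) na lev] unfolding uw(4,5)
      by blast
    have "card S \<le> m div 2 + 1" by (rule small[OF m(1) S(1,2)])
    then have le: "2 + i div 2 + (m - j) div 2 \<le> m div 2 + 1" using S(3) by simp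
    \<comment> \<open>The \<open>t\<close> levels above \<open>j\<close> cancel, leaving
      \<open>1 + i div 2 \<le> j div 2\<close>; this fails for \<open>j = i\<close>, and for
      \<open>j = i + 1\<close> with \<open>i\<close> even.\<close>
    from m(2,3) obtain t where t: "m = j + 2 * t"
      by (metis le_add_diff_inverse even_add evenE)
    then have "1 + i div 2 \<le> j div 2" using le by simp
    then show False using ij(1) by auto
  qed
  have ne: "sphere x i \<noteq> {}" if i: "i \<le> M" for i
  proof -
    have "i \<le> vdist x z" using i far(2) by simp
    then obtain v where "v \<in> pverts G" "vdist x v = i" by (rule vdist_level[OF x far(1)])
    then show ?thesis by (auto simp: sphere_def)
  qed
  have clique: "is_clique (ball_graph x M) (sphere x i)" if "i \<le> M" for i
    using adj[of _ _ i i] that by (auto simp: is_clique_def sphere_def)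
  have join: "(u, v) \<in> parcs (ball_graph x M)"
    if "i \<in> {0..M - 1}" "even i" "u \<in> sphere x i" "v \<in> sphere x (Suc i)" for i u v
  proof -
    have "Suc i \<le> M" using that(1) M by auto
    moreover have "u \<noteq> v" using that(3,4) by (auto simp: sphere_def)
    ultimately show ?thesis using adj[of u v i "Suc i"] that by (auto simp: sphere_def)
  qed
  have x0: "sphere x 0 = {x}" using vdist_eq_0[OF x] x by (auto simp: sphere_def)
  have lev: "graph_dist (ball_graph x M) x y = enat i" if "i \<in> {0..M}" "y \<in> sphere x i" for i y
    using graph_dist_ball_graph[OF x, of y M] that by (auto simp: sphere_def)
  show ?thesis unfolding strip_def
  proof (intro conjI)
    show "pair_graph (ball_graph x M)" by (rule pair_graph_ball_graph)
    show "pverts (ball_graph x M) = (\<Union>i\<in>{0..M}. sphere x i)" by (auto simp: sphere_def)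
    show "disjoint_family_on (sphere x) {0..M}"
      by (auto simp: disjoint_family_on_def sphere_def)
    show "\<forall>i\<in>{0..M}. sphere x i \<noteq> {} \<and> is_clique (ball_graph x M) (sphere x i)"
      using ne clique by simp
    show "\<exists>x'. sphere x 0 = {x'} \<and>
        (\<forall>i\<in>{0..M}. \<forall>y\<in>sphere x i. graph_dist (ball_graph x M) x' y = enat i)"
      using x0 lev by blast
    show "\<forall>i\<in>{0..M - 1}. even i \<longrightarrow>
        (\<forall>u\<in>sphere x i. \<forall>v\<in>sphere x (Suc i). (u, v) \<in> parcs (ball_graph x M))"
      using join by blast
  qed (rule M)
qed


section \<open>Simple lower bounds for the two independence numbers\<close>

lemma half_dist_lt_independence_number:
  assumes "x \<in> pverts G" "y \<in> pverts G"
  shows "vdist x y div 2 + 1 \<le> independence_number G"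
proof -
  have "\<exists>z\<in>pverts G. 2 * (vdist x y div 2) \<le> vdist x z" using assms(2) by force
  then show ?thesis
    using card_geodesic_sum_le_independence_number[of "{x}" "\<lambda>_. vdist x y div 2" "{}"] assms(1)
    by (simp add: independent_set_def)
qed

lemma two_le_vdist:
  assumes "x \<in> pverts G" "y \<in> pverts G" "x \<noteq> y" "(x, y) \<notin> parcs G"
  shows "2 \<le> vdist x y"
  using vdist_le_1[OF assms(1,2)] assms(3,4) by linarith

lemma obtain_other:
  assumes "2 \<le> card X" "x \<in> X"
  obtains y where "y \<in> X" "y \<noteq> x"
proof -
  have "\<not> X \<subseteq> {x}" using assms(1) card_mono[of "{x}" X] by auto
  then show ?thesis using that by blast
qed

text \<open>A second member of \<open>X\<close> lies at distance greater than \<open>c\<close>,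
  which supplies the eccentricity condition; hence the requirement of two elements.\<close>

lemma constant_broadcast:
  assumes X: "X \<subseteq> pverts G" "2 \<le> card X"
    and sep: "\<And>x y. x \<in> X \<Longrightarrow> y \<in> X \<Longrightarrow> x \<noteq> y \<Longrightarrow> c < vdist x y"
  shows "c * card X \<le> broadcast_independence_number G"
proof -
  define f where "f v = (if v \<in> X then c else 0)" for v
  have "\<exists>y\<in>pverts G. f x \<le> vdist x y" if "x \<in> pverts G" for x
  proof (cases "x \<in> X")
    case True
    then obtain y where "y \<in> X" "y \<noteq> x" using obtain_other X(2) by metis
    then show ?thesis using sep[of x y] True X(1) by (intro bexI[of _ y]) (auto simp: f_def)
  next
    case False
    then show ?thesis using that by (auto simp: f_def)
  qed
  then have "independent_broadcast G f"
    using sep by (auto simp: independent_broadcast_iff f_def split: if_splits)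
  then have "broadcast_weight G f \<le> broadcast_independence_number G"
    by (rule weight_le_broadcast_independence_number)
  moreover have "broadcast_weight G f = (\<Sum>v\<in>X. c)" unfolding broadcast_weight_def f_def
    using X(1) by (intro sum.mono_neutral_cong_right) (auto simp: pair_finite_verts)
  ultimately show ?thesis by (simp add: mult.commute)
qed

lemma pair_broadcast:
  assumes "x \<in> pverts G" "y \<in> pverts G" "c < vdist x y"
  shows "2 * c \<le> broadcast_independence_number G"
proof -
  have "x \<noteq> y" using assms by auto
  then have "c * card {x, y} \<le> broadcast_independence_number G"
    using assms vdist_sym[of x y] by (intro constant_broadcast) auto
  then show ?thesis using \<open>x \<noteq> y\<close> by simp
qed

section \<open>Membership in the extremal classes from tight independence numbers\<close>

text \<open>The levels \<open>0, 2, ..., 2 * n\<close> around \<open>x\<close> and around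
  \<open>y\<close> already give \<open>2 * n + 2\<close> independent vertices. As this is the
  maximum, neither ball of radius \<open>2 * n + 1\<close> holds more than its share, and no vertex
  lies outside both.\<close>

lemma class_G2_atI:
  assumes x: "x \<in> pverts G" and y: "y \<in> pverts G" and xy: "4 * n + 3 \<le> vdist x y"
    and alpha: "independence_number G = 2 * n + 2"
  shows "G \<in> class_G2_at n"
proof -
  define M where "M = 2 * n + 1"
  have strips: "strip M (ball_graph a M) (sphere a)"
    if a: "a \<in> pverts G" and b: "b \<in> pverts G" and ab: "4 * n + 3 \<le> vdist a b" for a b
  proof (rule strip_ball_graph[OF a _ b])
    fix S m assume m: "m = M - 1 \<or> m = M" and S: "independent_set G S"
      "\<And>s. s \<in> S \<Longrightarrow> vdist a s \<le> m"
    \<comment> \<open>\<open>S\<close> stays within distance \<open>2 * n + 1\<close> of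
      \<open>a\<close>, so it can be combined with \<open>n + 1\<close> vertices around
      \<open>b\<close>.\<close>
    have "2 * n + 2 \<le> vdist b s" if s: "s \<in> S" for s
    proof -
      have "s \<in> pverts G" using S(1) s by (auto simp: independent_set_def)
      then have "vdist a b \<le> vdist a s + vdist b s"
        using vdist_triangle[OF a _ b, of s] vdist_sym[OF b, of s] by simp
      then show ?thesis using ab S(2)[OF s] m by (auto simp: M_def)
    qed
    moreover have "2 * n \<le> vdist b a" using ab vdist_sym[OF a b] by simp
    ultimately have "card S + (n + 1) \<le> independence_number G"
      using card_geodesic_sum_le_independence_number[of "{b}" "\<lambda>_. n" S] a b S(1) by auto
    then show "card S \<le> m div 2 + 1" using alpha m by (auto simp: M_def)
  qed (use ab in \<open>simp_all add: M_def\<close>)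
  have yx: "4 * n + 3 \<le> vdist y x" using xy vdist_sym[OF x y] by simp
  \<comment> \<open>A vertex outside both balls could be added to the two families, giving
    \<open>2 * n + 3\<close> independent vertices.\<close>
  have cover: "vdist x v \<le> M \<or> vdist y v \<le> M" if v: "v \<in> pverts G" for v
  proof (rule ccontr)
    assume "\<not> ?thesis"
    moreover have "x \<noteq> y" using xy y by auto
    moreover have "\<exists>b\<in>pverts G. 2 * n \<le> vdist a b" if "a \<in> {x, y}" for a
    proof -
      have "2 * n \<le> vdist x y" "2 * n \<le> vdist y x" using xy yx by simp_all
      then show ?thesis using that x y by blast
    qed
    ultimately have "card {v} + (\<Sum>a\<in>{x, y}. n + 1) \<le> independence_number G"
      using x y v xy yx
      by (intro card_geodesic_sum_le_independence_number) (auto simp: independent_set_def M_def)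
    then show False using \<open>x \<noteq> y\<close> alpha by simp
  qed
  have far: "2 * M + 1 \<le> vdist x u + vdist u v + vdist y v"
    if "u \<in> pverts G" "v \<in> pverts G" for u v
    using vdist_triangle[OF x that(1) y] vdist_triangle[OF that(1,2) y] vdist_sym[OF that(2) y] xy
    by (simp add: M_def)
  have disj: "pverts (ball_graph x M) \<inter> pverts (ball_graph y M) = {}"
    using far by fastforce
  define F where "F = {(a, b) \<in> parcs G. vdist x a = M \<and> vdist y b = M}"
  have "F \<subseteq> sphere x M \<times> sphere y M" by (auto simp: F_def sphere_def dest: wellformed')
  moreover have "pverts G = pverts (ball_graph x M) \<union> pverts (ball_graph y M)"
    using cover by auto
  moreover have "parcs G = parcs (ball_graph x M) \<union> parcs (ball_graph y M) \<union> F \<union> F\<inverse>"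
  proof -
    \<comment> \<open>The distance \<open>2 * M + 1\<close> between the centres leaves one arc for
      the crossing only if both ends are on the outermost spheres.\<close>
    have cross: "vdist x a = M \<and> vdist y b = M"
      if "(a, b) \<in> parcs G" "vdist x a \<le> M" "vdist y b \<le> M" for a b
      using far[of a b] vdist_arc[of a b] that wellformed'[OF that(1)] by fastforce
    have "e \<in> parcs (ball_graph x M) \<union> parcs (ball_graph y M) \<union> F \<union> F\<inverse>" if e: "e \<in> parcs G" for e
    proof -
      obtain a b where ab: "e = (a, b)" by (cases e)
      have ba: "(b, a) \<in> parcs G" using e ab arcs_symmetric by simp
      consider "vdist x a \<le> M" "vdist x b \<le> M" | "vdist y a \<le> M" "vdist y b \<le> M"
        | "vdist x a \<le> M" "vdist y b \<le> M" | "vdist y a \<le> M" "vdist x b \<le> M"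
        using cover e ab wellformed' by blast
      then show ?thesis
        using cross[of a b] cross[of b a] e ba ab by cases (auto simp: F_def)
    qed
    then show ?thesis by (auto simp: F_def intro: arcs_symmetric)
  qed
  ultimately show ?thesis unfolding class_G2_at_def M_def[symmetric]
    using pair_graph conn disj strips[OF x y xy] strips[OF y x yx] by blast
qed

text \<open>The levels \<open>0, 2, ..., 2 * K x - 2\<close> around all centres give all but one of
  the independent vertices. Hence the vertices outside form a clique, which makes all
  \<open>K x\<close> equal and the balls of radius \<open>2 * K x\<close> strips.\<close>

lemma class_G0I:
  assumes X: "X \<subseteq> pverts G" "2 \<le> card X"
    and K: "\<And>x. x \<in> X \<Longrightarrow> 1 \<le> K x"
    and sep: "\<And>x y. x \<in> X \<Longrightarrow> y \<in> X \<Longrightarrow> x \<noteq> y \<Longrightarrow> 4 * K x + 1 \<le> vdist x y"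
    and alpha: "independence_number G = (\<Sum>x\<in>X. K x) + 1"
  shows "G \<in> class_G0"
proof -
  have fin: "finite X" using X(1) pair_finite_verts by (rule finite_subset)
  have XV: "x \<in> pverts G" if "x \<in> X" for x using that X(1) by auto
  have sep': "4 * K y + 1 \<le> vdist x y" if "x \<in> X" "y \<in> X" "x \<noteq> y" for x y
    using sep[of y x] that vdist_sym[OF XV XV] by simp
  have far: "\<exists>y\<in>pverts G. 4 * K x + 1 \<le> vdist x y" if "x \<in> X" for x
    using obtain_other[OF X(2) that] sep[OF that] XV by metis
  \<comment> \<open>This will be the central clique: \<open>R\<close> together with the last parts
    of all strips.\<close>
  define U where "U = {v \<in> pverts G. \<forall>x\<in>X. 2 * K x \<le> vdist x v}"
  \<comment> \<open>Two nonadjacent vertices of \<open>U\<close> could both be added to the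
    \<open>K x\<close> vertices around each centre, one too many.\<close>
  have U: "(u, w) \<in> parcs G" if uw: "u \<in> U" "w \<in> U" "u \<noteq> w" for u w
  proof (rule ccontr)
    assume na: "(u, w) \<notin> parcs G"
    have "card {u, w} + (\<Sum>x\<in>X. (K x - 1) + 1) \<le> independence_number G"
    proof (rule card_geodesic_sum_le_independence_number[OF fin X(1)])
      show "\<exists>y\<in>pverts G. 2 * (K x - 1) \<le> vdist x y" if "x \<in> X" for x
        using far[OF that] by force
      show "2 * (K x - 1) + 2 * (K y - 1) + 2 \<le> vdist x y" if "x \<in> X" "y \<in> X" "x \<noteq> y" for x y
        using sep[OF that] sep'[OF that] K[OF that(1)] K[OF that(2)] by simp
      show "independent_set G {u, w}"
        using uw na arcs_symmetric[of w u] by (auto simp: independent_set_def U_def)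
      show "2 * (K x - 1) + 2 \<le> vdist x v" if "x \<in> X" "v \<in> {u, w}" for x v
        using uw(1,2) that K[OF that(1)] by (auto simp: U_def)
    qed
    moreover have "(\<Sum>x\<in>X. (K x - 1) + 1) = (\<Sum>x\<in>X. K x)"
      by (intro sum.cong refl le_add_diff_inverse2 K)
    ultimately show False using alpha uw(3) by simp
  qed
  \<comment> \<open>Averaging the bounds \<open>4 * K x + 1\<close> and \<open>4 * K y + 1\<close>
    on the distance leaves more than \<open>2 * K y\<close> from \<open>y\<close> to
    \<open>u\<close>.\<close>
  have top: "u \<in> U" if "x \<in> X" "u \<in> pverts G" "vdist x u = 2 * K x" for x u
  proof -
    have "2 * K y \<le> vdist y u" if "y \<in> X" "y \<noteq> x" for y
      using vdist_triangle[OF XV[OF \<open>x \<in> X\<close>] \<open>u \<in> pverts G\<close> XV[OF that(1)]] \<open>vdist x u = _\<close>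
        sep[of x y] sep'[of x y] that \<open>x \<in> X\<close> vdist_sym[OF \<open>u \<in> pverts G\<close> XV[OF that(1)]] by simp
    moreover have "2 * K x \<le> vdist x u" using that(3) by simp
    ultimately show ?thesis using that(2) unfolding U_def by blast
  qed
  \<comment> \<open>Top vertices of the two centres lie in the clique \<open>U\<close>, so
    \<open>4 * K x + 1 \<le> vdist x y \<le> 2 * K x + 1 + 2 * K y\<close>.\<close>
  have K_le: "K x \<le> K y" if xy: "x \<in> X" "y \<in> X" for x y
  proof (cases "x = y")
    case False
    have ex: "\<exists>u. u \<in> pverts G \<and> vdist a u = 2 * K a" if a: "a \<in> X" for a
    proof -
      obtain b where b: "b \<in> pverts G" "4 * K a + 1 \<le> vdist a b" using far[OF a] by blast
      then have "2 * K a \<le> vdist a b" by simp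
      then show ?thesis using vdist_level[OF XV[OF a] b(1)] by metis
    qed
    obtain u where u: "u \<in> pverts G" "vdist x u = 2 * K x" using ex xy(1) by blast
    obtain w where w: "w \<in> pverts G" "vdist y w = 2 * K y" using ex xy(2) by blast
    have "vdist u w \<le> 1"
      using U[OF top[OF xy(1) u] top[OF xy(2) w]] vdist_arc[of u w] w(1) by (cases "u = w") auto
    then have "vdist x y \<le> 2 * K x + (1 + 2 * K y)"
      using vdist_triangle[OF XV[OF xy(1)] u(1) XV[OF xy(2)]]
        vdist_triangle[OF u(1) w(1) XV[OF xy(2)]] vdist_sym[OF w(1) XV[OF xy(2)]] u(2) w(2)
      by simp
    then show ?thesis using sep[OF xy False] by simp
  qed simp
  obtain x0 where x0: "x0 \<in> X" using X(2) by fastforce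
  define k where "k = K x0"
  have Kk: "K x = k" if "x \<in> X" for x using K_le that x0 by (simp add: k_def antisym)
  have k: "1 \<le> k" using K x0 by (simp add: k_def)
  have alphak: "independence_number G = k * card X + 1" using alpha Kk by simp
  have sepk: "4 * k + 1 \<le> vdist x y" if "x \<in> X" "y \<in> X" "x \<noteq> y" for x y
    using sep[OF that] Kk[OF that(1)] by simp
  have card_Diff: "card (X - {x}) = card X - 1" if "x \<in> X" for x
    using that fin by simp
  have cardX: "k * card X = k * (card X - 1) + k"
    using X(2) by (cases "card X") auto
  have strips: "strip (2 * k) (ball_graph x (2 * k)) (sphere x)" if x: "x \<in> X" for x
  proof -
    obtain z where z: "z \<in> X" "z \<noteq> x" by (rule obtain_other[OF X(2) x])
    have xz: "2 * k \<le> vdist x z" using sepk[of x z] x z by simp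
    show ?thesis
    proof (rule strip_ball_graph[OF XV[OF x] _ XV[OF z(1)] xz])
      fix S m assume m: "m = 2 * k - 1 \<or> m = 2 * k" and S: "independent_set G S"
        "\<And>s. s \<in> S \<Longrightarrow> vdist x s \<le> m"
      \<comment> \<open>Around the other centres \<open>k\<close> vertices are taken each. If the
        ball has radius only \<open>2 * k - 1\<close>, level \<open>2 * k\<close> around
        \<open>z\<close> is free as well, and this extra vertex lowers the bound on
        \<open>card S\<close> from \<open>k + 1\<close> to \<open>k\<close>.\<close>
      define h where "h y = k - 1 + (if m = 2 * k - 1 \<and> y = z then 1 else 0)" for y
      have "card S + (\<Sum>y\<in>X - {x}. h y + 1) \<le> independence_number G"
      proof (rule card_geodesic_sum_le_independence_number)
        show "\<exists>w\<in>pverts G. 2 * h y \<le> vdist y w" if "y \<in> X - {x}" for y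
          using sepk[of y x] x that k XV by (intro bexI[of _ x]) (auto simp: h_def)
        show "2 * h y + 2 * h w + 2 \<le> vdist y w" if "y \<in> X - {x}" "w \<in> X - {x}" "y \<noteq> w" for y w
          using sepk[of y w] that k by (auto simp: h_def)
        show "2 * h y + 2 \<le> vdist y s" if y: "y \<in> X - {x}" and s: "s \<in> S" for y s
        proof -
          have "s \<in> pverts G" using S(1) s by (auto simp: independent_set_def)
          then have "vdist x y \<le> vdist x s + vdist y s"
            using vdist_triangle[of x s y] vdist_sym[of y s] y x XV by simp
          then show ?thesis using sepk[of x y] x y S(2)[OF s] m k by (auto simp: h_def)
        qed
      qed (use fin X(1) S(1) in auto)
      moreover have "(\<Sum>y\<in>X - {x}. h y + 1) = (\<Sum>y\<in>X - {x}. k + (if m = 2 * k - 1 \<and> y = z then 1 else 0))"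
        by (rule sum.cong) (use k in \<open>auto simp: h_def\<close>)
      moreover have "\<dots> = k * (card X - 1) + (if m = 2 * k - 1 then 1 else 0)"
        using z x fin card_Diff[OF x] by (auto simp: sum.distrib)
      ultimately have "card S + (if m = 2 * k - 1 then 1 else 0) \<le> k + 1"
        using alphak cardX by simp
      then show "card S \<le> m div 2 + 1" using m k by (auto split: if_splits)
    qed (use k in simp)
  qed
  define l where "l = card X"
  obtain e where e: "bij_betw e {1..l} X" using ex_bij_betw_nat_finite_1[OF fin] l_def by auto
  have eX: "e ` {1..l} = X" using e by (simp add: bij_betw_def)
  have ein: "e i \<in> X" if "i \<in> {1..l}" for i using that eX by blast
  define R where "R = {v \<in> pverts G. \<forall>x\<in>X. 2 * k < vdist x v}"
  have UT: "R \<union> (\<Union>i\<in>{1..l}. sphere (e i) (2 * k)) = U"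
  proof -
    have "(\<Union>i\<in>{1..l}. sphere (e i) (2 * k)) = (\<Union>x\<in>X. sphere x (2 * k))" using eX by blast
    moreover have "R \<union> (\<Union>x\<in>X. sphere x (2 * k)) = U"
    proof (intro equalityI subsetI)
      fix v assume "v \<in> R \<union> (\<Union>x\<in>X. sphere x (2 * k))"
      then consider "v \<in> R" | x where "x \<in> X" "v \<in> sphere x (2 * k)" by blast
      then show "v \<in> U"
      proof cases
        case 1
        then show ?thesis using Kk by (simp add: R_def U_def less_imp_le)
      next
        case 2
        then show ?thesis using top Kk by (simp add: sphere_def)
      qed
    next
      fix v assume v: "v \<in> U"
      then have vV: "v \<in> pverts G" and le: "2 * k \<le> vdist x v" if "x \<in> X" for x
        using Kk that by (auto simp: U_def)
      show "v \<in> R \<union> (\<Union>x\<in>X. sphere x (2 * k))"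
      proof (cases "\<exists>x\<in>X. vdist x v = 2 * k")
        case True
        then show ?thesis using vV by (auto simp: sphere_def)
      next
        case False
        then show ?thesis using vV[OF x0] le by (auto simp: R_def order.strict_iff_order)
      qed
    qed
    ultimately show ?thesis by simp
  qed
  have disj: "disjoint_family_on (\<lambda>i. pverts (ball_graph (e i) (2 * k))) {1..l}"
    unfolding disjoint_family_on_def
  proof (intro ballI impI)
    fix i j assume ij: "i \<in> {1..l}" "j \<in> {1..l}" "i \<noteq> j"
    then have "e i \<noteq> e j" using bij_betw_imp_inj_on[OF e] by (metis inj_on_eq_iff)
    have "False" if v: "v \<in> pverts G" "vdist (e i) v \<le> 2 * k" "vdist (e j) v \<le> 2 * k" for v
      using vdist_triangle[OF XV[OF ein[OF ij(1)]] v(1) XV[OF ein[OF ij(2)]]]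
        vdist_sym[OF v(1) XV[OF ein[OF ij(2)]]] v
        sepk[OF ein[OF ij(1)] ein[OF ij(2)] \<open>e i \<noteq> e j\<close>] by simp
    then show "pverts (ball_graph (e i) (2 * k)) \<inter> pverts (ball_graph (e j) (2 * k)) = {}" by auto
  qed
  have parcs: "parcs G = (\<Union>i\<in>{1..l}. parcs (ball_graph (e i) (2 * k))) \<union>
      {(u, v). u \<noteq> v \<and> u \<in> U \<and> v \<in> U}"
  proof -
    \<comment> \<open>An end outside \<open>U\<close> is at distance less than \<open>2 * k\<close>
      from some centre, so the whole arc lies in the ball of radius \<open>2 * k\<close> around
      it.\<close>
    have *: "\<exists>i\<in>{1..l}. (a, b) \<in> parcs (ball_graph (e i) (2 * k))"
      if ab: "(a, b) \<in> parcs G" "\<not> (a \<in> U \<and> b \<in> U)" for a b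
    proof -
      obtain x where x: "x \<in> X" "vdist x a < 2 * k \<or> vdist x b < 2 * k"
        using ab Kk wellformed'[OF ab(1)] by (auto simp: U_def not_le)
      then have "vdist x a \<le> 2 * k \<and> vdist x b \<le> 2 * k"
        using vdist_arc_le[OF XV ab(1), of x] vdist_arc_le'[OF XV ab(1), of x] by auto
      moreover obtain i where "i \<in> {1..l}" "x = e i" using x(1) eX by blast
      ultimately show ?thesis using ab(1) by auto
    qed
    show ?thesis
    proof (rule set_eqI)
      fix q :: "'a \<times> 'a"
      obtain a b where "q = (a, b)" by (cases q)
      then show "q \<in> parcs G \<longleftrightarrow> q \<in> (\<Union>i\<in>{1..l}. parcs (ball_graph (e i) (2 * k))) \<union>
          {(u, v). u \<noteq> v \<and> u \<in> U \<and> v \<in> U}"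
        using *[of a b] U[of a b] no_loops'[of a b] by auto
    qed
  qed
  have verts: "pverts G = (\<Union>i\<in>{1..l}. pverts (ball_graph (e i) (2 * k))) \<union> R"
  proof -
    have eq: "(\<Union>i\<in>{1..l}. pverts (ball_graph (e i) (2 * k))) = (\<Union>x\<in>X. pverts (ball_graph x (2 * k)))"
      unfolding eX[symmetric] by blast
    have "pverts G = (\<Union>x\<in>X. pverts (ball_graph x (2 * k))) \<union> R"
    proof (intro equalityI subsetI)
      fix v assume v: "v \<in> pverts G"
      show "v \<in> (\<Union>x\<in>X. pverts (ball_graph x (2 * k))) \<union> R"
      proof (cases "\<exists>x\<in>X. vdist x v \<le> 2 * k")
        case True
        then show ?thesis using v by auto
      next
        case False
        then show ?thesis using v by (simp add: R_def not_le)
      qed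
    qed (auto simp: R_def)
    then show ?thesis unfolding eq .
  qed
  have RU: "R \<inter> (\<Union>i\<in>{1..l}. pverts (ball_graph (e i) (2 * k))) = {}"
  proof -
    have "v \<notin> pverts (ball_graph (e i) (2 * k))" if "v \<in> R" "i \<in> {1..l}" for v i
    proof -
      have "2 * k < vdist (e i) v" using that(1) ein[OF that(2)] unfolding R_def by blast
      then show ?thesis by simp
    qed
    then show ?thesis by blast
  qed
  have "finite R" using pair_finite_verts by (simp add: R_def)
  moreover have "\<forall>i\<in>{1..l}. strip (2 * k) (ball_graph (e i) (2 * k)) (sphere (e i))"
    using strips ein by blast
  ultimately have "G \<in> class_G0_at k l" unfolding class_G0_at_def
    using pair_graph disj parcs[folded UT] verts RU
    by (intro CollectI conjI exI[of _ "\<lambda>i. ball_graph (e i) (2 * k)"] exI[of _ "\<lambda>i. sphere (e i)"]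
        exI[of _ R])
  then show ?thesis unfolding class_G0_def using k X(2) l_def by auto
qed


subsection \<open>The upper bound and its equality case\<close>

lemma broadcast_weight_support:
  "broadcast_weight G f = (\<Sum>x\<in>{x \<in> pverts G. 0 < f x}. f x)"
  unfolding broadcast_weight_def
  by (rule sum.mono_neutral_right) (auto simp: pair_finite_verts)

lemma independent_broadcast_less_vdist:
  assumes "independent_broadcast G f"
    and "x \<in> pverts G" "y \<in> pverts G" "x \<noteq> y" "0 < f x" "0 < f y"
  shows "f x < vdist x y" "f y < vdist x y"
proof -
  have "max (f x) (f y) < vdist x y" using assms unfolding independent_broadcast_iff by blast
  then show "f x < vdist x y" "f y < vdist x y" by simp_all
qed

text \<open>Here \<open>large\<close> forces weight at least 3, by the value 2 on two vertices at
  distance 3 or more or the value 1 on a maximum independent set. A single positive value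
  \<open>f x\<close> would be beaten by \<open>f x - 1\<close> on \<open>x\<close> and on a vertex
  at distance at least \<open>f x\<close>.\<close>

lemma optimal_broadcast_support:
  assumes opt: "optimal_broadcast G f"
    and large: "3 \<le> graph_diameter G \<or> 3 \<le> independence_number G"
  shows "2 \<le> card {x \<in> pverts G. 0 < f x}"
proof (rule ccontr)
  define X where "X = {x \<in> pverts G. 0 < f x}"
  assume "\<not> ?thesis"
  then have "card X \<le> 1" by (simp add: X_def)
  have f: "independent_broadcast G f" and weight: "broadcast_independence_number G = (\<Sum>x\<in>X. f x)"
    using opt by (simp_all add: optimal_broadcast_def broadcast_weight_support X_def)
  have three: "3 \<le> broadcast_independence_number G"
    using large
  proof
    assume "3 \<le> graph_diameter G"
    then obtain x y where "x \<in> pverts G" "y \<in> pverts G" "3 \<le> vdist x y"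
      using le_graph_diameter_iff[of 2] by (auto simp: numeral_eq_enat)
    then show ?thesis using pair_broadcast[of x y 2] by simp
  next
    assume a: "3 \<le> independence_number G"
    obtain S where S: "independent_set G S" "card S = independence_number G"
      by (rule maximum_independent_set)
    have "1 * card S \<le> broadcast_independence_number G"
    proof (rule constant_broadcast)
      show "S \<subseteq> pverts G" using S(1) by (simp add: independent_set_def)
      show "1 < vdist x y" if "x \<in> S" "y \<in> S" "x \<noteq> y" for x y
      proof -
        have "x \<in> pverts G" "y \<in> pverts G" "(x, y) \<notin> parcs G"
          using S(1) that by (auto simp: independent_set_def)
        then show ?thesis using two_le_vdist[of x y] that(3) by simp
      qed
    qed (use S a in simp)
    then show ?thesis using S(2) a by simp
  qed
  have finX: "finite X" using pair_finite_verts by (simp add: X_def)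
  have "X \<noteq> {}" using three weight by auto
  then obtain x where x: "X = {x}" using \<open>card X \<le> 1\<close> finX
    by (metis One_nat_def card_0_eq card_1_singletonE le_SucE le_zero_eq)
  then have xV: "x \<in> pverts G" by (auto simp: X_def)
  then obtain y where y: "y \<in> pverts G" "f x \<le> vdist x y"
    using f by (auto simp: independent_broadcast_iff)
  have "broadcast_independence_number G = f x" using weight x by simp
  moreover from this have "2 * (f x - 1) \<le> f x"
    using pair_broadcast[OF xV y(1), of "f x - 1"] y(2) three by simp
  ultimately show False using three by simp
qed

text \<open>A second positive vertex is at distance more than \<open>f x\<close>, and every second
  level up to it gives independent vertices. If \<open>f x = 0\<close>, the bound of any positive
  vertex serves.\<close>

lemma broadcast_value_bound:
  assumes f: "independent_broadcast G f" and two: "2 \<le> card {x \<in> pverts G. 0 < f x}"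
    and x: "x \<in> pverts G"
  shows "f x + 2 \<le> 2 * independence_number G"
proof -
  have *: "f x + 2 \<le> 2 * independence_number G" if x: "x \<in> {x \<in> pverts G. 0 < f x}" for x
  proof -
    obtain y where y: "y \<in> {x \<in> pverts G. 0 < f x}" "y \<noteq> x"
      by (rule obtain_other[OF two x])
    then have "f x + 1 \<le> vdist x y"
      using independent_broadcast_less_vdist(1)[OF f, of x y] x by simp
    then show ?thesis using half_dist_lt_independence_number[of x y] x y by auto
  qed
  show ?thesis
  proof (cases "0 < f x")
    case False
    obtain y where "y \<in> {x \<in> pverts G. 0 < f x}" using two
      by (metis card.empty ex_in_conv not_numeral_le_zero)
    then show ?thesis using *[of y] False by simp
  qed (use * x in auto)
qed

lemma broadcast_weight_bound:
  assumes f: "independent_broadcast G f" and two: "2 \<le> card {x \<in> pverts G. 0 < f x}"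
  shows "broadcast_weight G f + 4 \<le> 4 * independence_number G"
    and "broadcast_weight G f + 4 = 4 * independence_number G \<Longrightarrow> G \<in> class_G0 \<union> class_G2"
proof -
  define X where "X = {x \<in> pverts G. 0 < f x}"
  have X: "X \<subseteq> pverts G" "finite X" "2 \<le> card X"
    using two pair_finite_verts by (auto simp: X_def)
  have XV: "x \<in> pverts G" if "x \<in> X" for x using that X(1) by auto
  have weight: "broadcast_weight G f = (\<Sum>x\<in>X. f x)"
    by (simp add: broadcast_weight_support X_def)
  have sep: "f x < vdist x y" "f y < vdist x y" if "x \<in> X" "y \<in> X" "x \<noteq> y" for x y
    using independent_broadcast_less_vdist[OF f, of x y] that by (simp_all add: X_def)
  \<comment> \<open>This is \<open>f x / 4\<close> rounded up, since \<open>f x\<close> is positive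
    on \<open>X\<close>.\<close>
  define K where "K x = (f x - 1) div 4 + 1" for x
  have f_K: "f x \<le> 4 * K x" "4 * K x < f x + 4" if "x \<in> X" for x
    using that by (auto simp: K_def X_def)
  have K_pos: "1 \<le> K x" for x by (simp add: K_def)
  have far: "\<exists>y\<in>pverts G. n \<le> vdist x y" if x: "x \<in> X" and n: "n \<le> Suc (f x)" for x n
  proof -
    obtain y where "y \<in> X" "y \<noteq> x" by (rule obtain_other[OF X(3) x])
    then show ?thesis using sep[of x y] x n XV by (intro bexI[of _ y]) auto
  qed
  \<comment> \<open>The basic construction with empty \<open>Y\<close>, its distance conditions
    expressed by the broadcast values.\<close>
  have select: "(\<Sum>x\<in>X. h x + 1) \<le> independence_number G"
    if h: "\<And>x. x \<in> X \<Longrightarrow> 2 * h x \<le> Suc (f x)"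
      "\<And>x y. x \<in> X \<Longrightarrow> y \<in> X \<Longrightarrow> x \<noteq> y \<Longrightarrow> 2 * h x + 2 * h y + 1 \<le> max (f x) (f y)" for h
  proof -
    have "card ({} :: 'a set) + (\<Sum>x\<in>X. h x + 1) \<le> independence_number G"
    proof (rule card_geodesic_sum_le_independence_number)
      show "2 * h x + 2 * h y + 2 \<le> vdist x y" if "x \<in> X" "y \<in> X" "x \<noteq> y" for x y
        using h(2)[OF that] sep[OF that] by linarith
      show "\<exists>y\<in>pverts G. 2 * h x \<le> vdist x y" if "x \<in> X" for x
        by (rule far[OF that h(1)[OF that]])
    qed (simp_all add: X independent_set_def)
    then show ?thesis by simp
  qed
  have "broadcast_weight G f + 4 \<le> 4 * independence_number G \<and>
    (broadcast_weight G f + 4 = 4 * independence_number G \<longrightarrow> G \<in> class_G0 \<union> class_G2)"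
  proof (cases "\<exists>x\<in>X. f x mod 4 = 0 \<or> f x mod 4 = 3")
    case True
    then obtain z where z: "z \<in> X" "f z mod 4 = 0 \<or> f z mod 4 = 3" by (rule bexE)
    have "4 * ((n - 1) div 4 + 1) \<le> n + 1" if "0 < n" "n mod 4 = 0 \<or> n mod 4 = 3" for n :: nat
      using that by presburger
    then have fz: "4 * K z \<le> f z + 1" using z by (simp only: K_def X_def mem_Collect_eq)
    \<comment> \<open>Level \<open>2 * K z\<close> is added around \<open>z\<close> only; the other
      centres stop at \<open>2 * K x - 2\<close>.\<close>
    define h where "h x = K x - 1 + (if x = z then 1 else 0)" for x
    have h: "4 * h x + 1 \<le> f x" if "x \<in> X" "x \<noteq> z" for x
      using f_K(2)[OF that(1)] K_pos[of x] that(2) by (simp add: h_def)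
    have hz: "4 * h z \<le> f z + 1" using fz by (simp add: h_def K_def)
    have "(\<Sum>x\<in>X. h x + 1) \<le> independence_number G"
    proof (rule select)
      show "2 * h x \<le> Suc (f x)" if "x \<in> X" for x
        using h[OF that] hz by (cases "x = z") auto
      show "2 * h x + 2 * h y + 1 \<le> max (f x) (f y)" if xy: "x \<in> X" "y \<in> X" "x \<noteq> y" for x y
      proof -
        \<comment> \<open>The weaker bound at \<open>z\<close> is enough: if
          \<open>a \<le> b\<close> then \<open>q\<close> dominates, otherwise
          \<open>a \<ge> b + 1\<close> and \<open>4 * a - 1 \<le> p\<close> does.\<close>
        have arith: "2 * a + 2 * b + 1 \<le> max p q" if "4 * a \<le> p + 1" "4 * b + 1 \<le> q" for a b p q :: nat
          using that by (cases "a \<le> b") linarith+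
        consider "x = z" "y \<noteq> z" | "x \<noteq> z" "y = z" | "x \<noteq> z" "y \<noteq> z" using xy(3) by blast
        then show ?thesis
        proof cases
          case 1
          then show ?thesis using arith[OF hz h[OF xy(2)]] by simp
        next
          case 2
          then show ?thesis using arith[OF hz h[OF xy(1)]] by (simp add: max.commute add.commute)
        next
          case 3
          then show ?thesis using h[OF xy(1)] h[OF xy(2)] by linarith
        qed
      qed
    qed
    moreover have "(\<Sum>x\<in>X. h x + 1) = (\<Sum>x\<in>X. K x + (if x = z then 1 else 0))"
      by (rule sum.cong) (simp_all add: h_def K_def)
    moreover have "\<dots> = (\<Sum>x\<in>X. K x) + 1" using z(1) X(2) by (simp add: sum.distrib)
    ultimately have alpha: "(\<Sum>x\<in>X. K x) + 1 \<le> independence_number G" by simp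
    have le: "(\<Sum>x\<in>X. f x) \<le> (\<Sum>x\<in>X. 4 * K x)" using f_K(1) by (rule sum_mono)
    have "G \<in> class_G0" if eq: "broadcast_weight G f + 4 = 4 * independence_number G"
    proof -
      \<comment> \<open>Equality collapses the chain from \<open>\<Sum> f\<close> over
        \<open>4 * \<Sum> K\<close> to \<open>4 * \<alpha> - 4\<close>, and then
        \<open>f x = 4 * K x\<close> holds termwise.\<close>
      have sums: "(\<Sum>x\<in>X. f x) = (\<Sum>x\<in>X. 4 * K x)"
        using eq alpha le weight by (simp add: sum_distrib_left[symmetric])
      have f4: "f x = 4 * K x" if "x \<in> X" for x
        by (rule sum_mono_inv[OF sums f_K(1) that X(2)])
      show ?thesis
      proof (rule class_G0I[OF X(1,3)])
        show "4 * K x + 1 \<le> vdist x y" if "x \<in> X" "y \<in> X" "x \<noteq> y" for x y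
          using sep(1)[OF that] f4[OF that(1)] by simp
        show "independence_number G = (\<Sum>x\<in>X. K x) + 1"
          using eq weight sums by (simp add: sum_distrib_left[symmetric])
      qed (simp add: K_def)
    qed
    then show ?thesis using alpha le weight by (simp add: sum_distrib_left[symmetric])
  next
    case False
    \<comment> \<open>For residues 1 and 2 rounding up gains at least 2 per vertex, and with two or
      more positive vertices this provides the 4 in the bound.\<close>
    have f2: "f x + 2 \<le> 4 * K x" if "x \<in> X" for x
    proof -
      have "n + 2 \<le> 4 * ((n - 1) div 4 + 1)" if "0 < n" "n mod 4 \<noteq> 0" "n mod 4 \<noteq> 3" for n :: nat
        using that by presburger
      moreover have "0 < f x" "f x mod 4 \<noteq> 0" "f x mod 4 \<noteq> 3"
        using False that by (auto simp: X_def)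
      ultimately show ?thesis unfolding K_def by blast
    qed
    have "(\<Sum>x\<in>X. (K x - 1) + 1) \<le> independence_number G"
    proof (rule select)
      show "2 * (K x - 1) \<le> Suc (f x)" if "x \<in> X" for x using f_K(2)[OF that] by linarith
      show "2 * (K x - 1) + 2 * (K y - 1) + 1 \<le> max (f x) (f y)"
        if "x \<in> X" "y \<in> X" "x \<noteq> y" for x y
        using f_K(2)[OF that(1)] f_K(2)[OF that(2)] f2[OF that(1)] f2[OF that(2)] by linarith
    qed
    then have alpha: "(\<Sum>x\<in>X. K x) \<le> independence_number G" by (simp add: K_def)
    have le: "(\<Sum>x\<in>X. f x + 2) \<le> (\<Sum>x\<in>X. 4 * K x)" using f2 by (rule sum_mono)
    have sum2: "(\<Sum>x\<in>X. f x + 2) = (\<Sum>x\<in>X. f x) + 2 * card X" by (simp only: sum.distrib sum_constant) simp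
    have "G \<in> class_G2" if eq: "broadcast_weight G f + 4 = 4 * independence_number G"
    proof -
      have sums: "(\<Sum>x\<in>X. f x + 2) = (\<Sum>x\<in>X. 4 * K x)" and card: "card X = 2"
        and alphaK: "independence_number G = (\<Sum>x\<in>X. K x)"
        using eq alpha le weight X(3) unfolding sum2 sum_distrib_left[symmetric] by linarith+
      have f4: "f x + 2 = 4 * K x" if "x \<in> X" for x
        by (rule sum_mono_inv[OF sums f2 that X(2)])
      obtain x y where xy: "X = {x, y}" "x \<noteq> y" using card by (auto simp: card_2_iff)
      then have dist: "4 * K x - 1 \<le> vdist x y" "4 * K y - 1 \<le> vdist x y"
        using sep[of x y] f4[of x] f4[of y] by auto
      \<comment> \<open>The distance is at least four times the larger \<open>K\<close> minus 1, so
        the left side is at least twice the larger \<open>K\<close>; hence both agree.\<close>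
      have "vdist x y div 2 + 1 \<le> K x + K y"
        using half_dist_lt_independence_number[of x y] XV xy alphaK by simp
      moreover have "1 \<le> K x" "1 \<le> K y" by (simp_all add: K_def)
      ultimately have "K x = K y" using dist by presburger
      then have "4 * (K x - 1) + 3 \<le> vdist x y" "independence_number G = 2 * (K x - 1) + 2"
        using dist alphaK xy \<open>1 \<le> K x\<close> by simp_all
      then have "G \<in> class_G2_at (K x - 1)" by (intro class_G2_atI[of x y] XV) (simp_all add: xy)
      then show ?thesis by (auto simp: class_G2_def)
    qed
    then show ?thesis using alpha le weight X(3) unfolding sum2 sum_distrib_left[symmetric]
      by (intro conjI impI UnI2) simp_all
  qed
  then show "broadcast_weight G f + 4 \<le> 4 * independence_number G"
    and "broadcast_weight G f + 4 = 4 * independence_number G \<Longrightarrow> G \<in> class_G0 \<union> class_G2"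
    by blast+
qed

end

subsection \<open>Members of the extremal classes\<close>

text \<open>The inverse of the indexing \<open>B\<close>: the distance inside the strip from its
  centre.\<close>

definition strip_level :: "'a pair_pre_digraph \<Rightarrow> (nat \<Rightarrow> 'a set) \<Rightarrow> 'a \<Rightarrow> nat" where
  "strip_level H B v = the_enat (graph_dist H (the_elem (B 0)) v)"

text \<open>The last fact holds because levels \<open>2 * j\<close> and \<open>2 * j + 1\<close> are
  cliques that are completely joined. These pairs form the clique covers of the extremal
  graphs.\<close>

lemma
  assumes "strip m H B"
  shows strip_levelD: "i \<le> m \<Longrightarrow> v \<in> B i \<Longrightarrow> v \<in> pverts H \<and> strip_level H B v = i"
    and strip_level_mem: "v \<in> pverts H \<Longrightarrow> strip_level H B v \<le> m \<and> v \<in> B (strip_level H B v)"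
    and strip_level_arc: "(a, b) \<in> parcs H \<Longrightarrow>
      a \<in> pverts H \<and> b \<in> pverts H \<and> strip_level H B b \<le> Suc (strip_level H B a)"
    and strip_level_adjacent: "u \<in> pverts H \<Longrightarrow> v \<in> pverts H \<Longrightarrow> u \<noteq> v \<Longrightarrow>
      strip_level H B u div 2 = strip_level H B v div 2 \<Longrightarrow> (u, v) \<in> parcs H"
proof -
  from assms have m: "m > 0" and H: "pair_graph H" and verts: "pverts H = (\<Union>i\<in>{0..m}. B i)"
    and clique: "\<And>i. i \<le> m \<Longrightarrow> is_clique H (B i)"
    and join: "\<And>i u v. i \<le> m - 1 \<Longrightarrow> even i \<Longrightarrow> u \<in> B i \<Longrightarrow> v \<in> B (Suc i) \<Longrightarrow> (u, v) \<in> parcs H"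
    unfolding strip_def by auto
  interpret H: pair_graph H by (rule H)
  from assms obtain x where x: "B 0 = {x}"
    and dist: "\<And>i y. i \<le> m \<Longrightarrow> y \<in> B i \<Longrightarrow> graph_dist H x y = enat i"
    unfolding strip_def by (metis atLeastAtMost_iff le0)
  let ?lev = "strip_level H B"
  have lev: "v \<in> pverts H \<and> ?lev v = i" if "i \<le> m" "v \<in> B i" for i v
    using dist[OF that] that verts x by (auto simp: strip_level_def)
  have lev': "?lev v \<le> m \<and> v \<in> B (?lev v) \<and> graph_dist H x v = enat (?lev v)"
    if "v \<in> pverts H" for v
    using that verts lev dist by auto
  have step: "(u, v) \<in> parcs H"
    if uv: "u \<in> pverts H" "v \<in> pverts H" "?lev v = Suc (?lev u)" "even (?lev u)" for u v
    using join[of "?lev u" u v] lev'[OF uv(1)] lev'[OF uv(2)] uv(3,4) m by auto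
  show "i \<le> m \<Longrightarrow> v \<in> B i \<Longrightarrow> v \<in> pverts H \<and> ?lev v = i" by (rule lev)
  show "v \<in> pverts H \<Longrightarrow> ?lev v \<le> m \<and> v \<in> B (?lev v)" using lev' by simp
  show "a \<in> pverts H \<and> b \<in> pverts H \<and> ?lev b \<le> Suc (?lev a)" if ab: "(a, b) \<in> parcs H"
    using H.graph_dist_arc_le[OF ab, of x] lev'[of a] lev'[of b] H.wellformed'[OF ab]
    by (simp add: one_enat_def)
  show "(u, v) \<in> parcs H"
    if uv: "u \<in> pverts H" "v \<in> pverts H" "u \<noteq> v" "?lev u div 2 = ?lev v div 2"
  proof -
    have "p = q \<or> q = Suc p \<and> even p \<or> p = Suc q \<and> even q" if "p div 2 = q div 2" for p q :: nat
      using that by presburger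
    from this[OF uv(4)] have "?lev u = ?lev v \<or> ?lev v = Suc (?lev u) \<and> even (?lev u) \<or>
      ?lev u = Suc (?lev v) \<and> even (?lev v)" .
    then consider "?lev u = ?lev v" | "?lev v = Suc (?lev u)" "even (?lev u)"
      | "?lev u = Suc (?lev v)" "even (?lev v)" by (elim disjE conjE)
    then show ?thesis
    proof cases
      case 1
      then show ?thesis using clique[of "?lev u"] lev'[OF uv(1)] lev'[OF uv(2)] uv(3)
        unfolding is_clique_def by metis
    next
      case 2
      then show ?thesis by (rule step[OF uv(1,2)])
    next
      case 3
      then show ?thesis by (rule H.arcs_symmetric[OF step[OF uv(2,1)]])
    qed
  qed
qed

context connected_pair_graph
begin

text \<open>Arcs outside the two strips meet them only in their last parts, so a walk between the
  centres climbs all \<open>M\<close> levels of both and uses at least one more arc. Arcs avoiding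
  both strips satisfy the last alternative of \<open>arcs\<close> vacuously.\<close>

lemma strips_centre_dist:
  assumes H1: "strip M H1 B1" "B1 0 = {x1}" and H2: "strip M H2 B2" "B2 0 = {x2}"
    and sub: "pverts H1 \<inter> pverts H2 = {}" "pverts H1 \<subseteq> pverts G" "pverts H2 \<subseteq> pverts G"
    and arcs: "\<And>a b. (a, b) \<in> parcs G \<Longrightarrow> (a, b) \<in> parcs H1 \<or> (a, b) \<in> parcs H2 \<or>
      (\<forall>v\<in>{a, b}. (v \<in> pverts H1 \<longrightarrow> v \<in> B1 M) \<and> (v \<in> pverts H2 \<longrightarrow> v \<in> B2 M))"
  shows "2 * M + 1 \<le> vdist x1 x2"
proof -
  let ?l1 = "strip_level H1 B1" and ?l2 = "strip_level H2 B2"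
  have "pair_graph H2" using H2(1) by (simp add: strip_def)
  then interpret H2: pair_graph H2 .
  \<comment> \<open>\<open>h\<close> rises from 0 at \<open>x1\<close> to \<open>2 * M + 1\<close> at \<open>x2\<close> and grows by at most 1 along an arc.\<close>
  define h where "h v = (if v \<in> pverts H1 then ?l1 v
    else if v \<in> pverts H2 then 2 * M + 1 - ?l2 v else M + 1)" for v
  have "h b \<le> Suc (h a)" if ab: "(a, b) \<in> parcs G" for a b
    using arcs[OF ab]
  proof (elim disjE)
    assume "(a, b) \<in> parcs H1"
    then show ?thesis using strip_level_arc[OF H1(1), of a b] by (simp add: h_def)
  next
    assume arc: "(a, b) \<in> parcs H2"
    have "b \<in> pverts H2 \<and> a \<in> pverts H2 \<and> ?l2 a \<le> Suc (?l2 b)"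
      by (rule strip_level_arc[OF H2(1) H2.arcs_symmetric[OF arc]])
    moreover from this have "a \<notin> pverts H1" "b \<notin> pverts H1" using sub(1) by blast+
    ultimately have "h a = 2 * M + 1 - ?l2 a" "h b = 2 * M + 1 - ?l2 b" "?l2 a \<le> Suc (?l2 b)"
      by (simp_all add: h_def)
    then show ?thesis by linarith
  next
    assume top: "\<forall>v\<in>{a, b}. (v \<in> pverts H1 \<longrightarrow> v \<in> B1 M) \<and> (v \<in> pverts H2 \<longrightarrow> v \<in> B2 M)"
    \<comment> \<open>Last parts and vertices outside both strips have adjacent potential values, so
      such an arc changes \<open>h\<close> by at most 1.\<close>
    have "h v = M \<or> h v = M + 1" if "v \<in> {a, b}" for v
      using strip_levelD[OF H1(1), of M v] strip_levelD[OF H2(1), of M v] top that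
      by (auto simp: h_def)
    from this[of a] this[of b] show ?thesis by auto
  qed
  then have pot: "enat (h x2) \<le> enat (h x1) + graph_dist G x1 x2" by (rule graph_dist_potential)
  have x1: "x1 \<in> pverts H1" "?l1 x1 = 0" using strip_levelD[OF H1(1), of 0 x1] H1(2) by auto
  have x2: "x2 \<in> pverts H2" "?l2 x2 = 0" using strip_levelD[OF H2(1), of 0 x2] H2(2) by auto
  have "graph_dist G x1 x2 = enat (vdist x1 x2)"
    by (rule graph_dist_eq) (use x1(1) x2(1) sub(2,3) in auto)
  moreover have "x2 \<notin> pverts H1" using sub(1) x2(1) by blast
  ultimately show ?thesis using pot x1 x2 by (simp add: h_def)
qed

text \<open>The value \<open>2 * M = 4 * k + 2\<close> on both centres has weight
  \<open>8 * k + 4\<close>, while pairs of consecutive levels cover the graph by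
  \<open>2 * k + 2\<close> cliques.\<close>

lemma class_G2_at_bound:
  assumes "G \<in> class_G2_at k"
  shows "4 * independence_number G \<le> broadcast_independence_number G + 4"
proof -
  define M where "M = 2 * k + 1"
  obtain H1 B1 H2 B2 F where H: "strip M H1 B1" "strip M H2 B2" "pverts H1 \<inter> pverts H2 = {}"
    "F \<subseteq> B1 M \<times> B2 M" "pverts G = pverts H1 \<union> pverts H2"
    "parcs G = parcs H1 \<union> parcs H2 \<union> F \<union> F\<inverse>"
    using assms unfolding class_G2_at_def M_def by blast
  let ?l1 = "strip_level H1 B1" and ?l2 = "strip_level H2 B2"
  obtain x1 where x1: "B1 0 = {x1}" using H(1) unfolding strip_def by (elim conjE exE)
  obtain x2 where x2: "B2 0 = {x2}" using H(2) unfolding strip_def by (elim conjE exE)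
  note x = x1 x2
  have top: "v \<in> pverts H1" if "v \<in> B1 M" for v using strip_levelD[OF H(1)] that by blast
  have top': "v \<in> pverts H2" if "v \<in> B2 M" for v using strip_levelD[OF H(2)] that by blast
  have "2 * M + 1 \<le> vdist x1 x2"
  proof (rule strips_centre_dist[OF H(1) x(1) H(2) x(2) H(3)])
    fix a b assume "(a, b) \<in> parcs G"
    then consider "(a, b) \<in> parcs H1" | "(a, b) \<in> parcs H2" | "a \<in> B1 M" "b \<in> B2 M"
      | "a \<in> B2 M" "b \<in> B1 M" using H(4,6) by blast
    then show "(a, b) \<in> parcs H1 \<or> (a, b) \<in> parcs H2 \<or>
      (\<forall>v\<in>{a, b}. (v \<in> pverts H1 \<longrightarrow> v \<in> B1 M) \<and> (v \<in> pverts H2 \<longrightarrow> v \<in> B2 M))"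
      using top top' H(3) by cases blast+
  qed (use H(5) in auto)
  moreover have "x1 \<in> pverts G" "x2 \<in> pverts G"
    using strip_levelD[OF H(1), of 0 x1] strip_levelD[OF H(2), of 0 x2] x H(5) by auto
  ultimately have "2 * (2 * M) \<le> broadcast_independence_number G"
    by (intro pair_broadcast[of x1 x2]) auto
  moreover have "independence_number G \<le> card ({0, 1::nat} \<times> {..k})"
  proof (rule independence_number_le_clique_cover)
    let ?C = "\<lambda>(s, j). if s = (0::nat) then {v \<in> pverts H1. ?l1 v div 2 = j}
      else {v \<in> pverts H2. ?l2 v div 2 = j}"
    show "\<exists>i\<in>{0, 1} \<times> {..k}. v \<in> ?C i" if v: "v \<in> pverts G" for v
    proof (cases "v \<in> pverts H1")
      case True
      then have "?l1 v \<le> 2 * k + 1" using strip_level_mem[OF H(1)] by (simp add: M_def)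
      then have "?l1 v div 2 \<le> k" by linarith
      then show ?thesis using True by (intro bexI[of _ "(0, ?l1 v div 2)"]) auto
    next
      case False
      then have v: "v \<in> pverts H2" using v H(5) by simp
      then have "?l2 v \<le> 2 * k + 1" using strip_level_mem[OF H(2)] by (simp add: M_def)
      then have "?l2 v div 2 \<le> k" by linarith
      then show ?thesis using v by (intro bexI[of _ "(1, ?l2 v div 2)"]) auto
    qed
    show "(u, v) \<in> parcs G" if "i \<in> {0, 1} \<times> {..k}" "u \<in> ?C i" "v \<in> ?C i" "u \<noteq> v" for i u v
    proof -
      obtain s j where i: "i = (s, j)" by (cases i)
      have "(u, v) \<in> parcs H1 \<or> (u, v) \<in> parcs H2"
        using that(2-4) strip_level_adjacent[OF H(1), of u v] strip_level_adjacent[OF H(2), of u v]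
        unfolding i by (cases "s = 0") simp_all
      then show ?thesis using H(6) by blast
    qed
  qed simp
  ultimately show ?thesis by (simp add: M_def card_cartesian_product)
qed

text \<open>The value \<open>4 * k\<close> on the \<open>l\<close> centres has weight
  \<open>4 * k * l\<close>, while level pairs together with the central clique \<open>U\<close> give
  \<open>k * l + 1\<close> cliques.\<close>

lemma class_G0_at_bound:
  assumes G: "G \<in> class_G0_at k l" and "2 \<le> l"
  shows "4 * independence_number G \<le> broadcast_independence_number G + 4"
proof -
  obtain H B R where strips: "\<forall>i\<in>{1..l}. strip (2 * k) (H i) (B i)"
    and H: "disjoint_family_on (\<lambda>i. pverts (H i)) {1..l}" "R \<inter> (\<Union>i\<in>{1..l}. pverts (H i)) = {}"
    "pverts G = (\<Union>i\<in>{1..l}. pverts (H i)) \<union> R"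
    "parcs G = (\<Union>i\<in>{1..l}. parcs (H i)) \<union>
              {(u, v). u \<noteq> v \<and> u \<in> R \<union> (\<Union>i\<in>{1..l}. B i (2 * k)) \<and>
                                v \<in> R \<union> (\<Union>i\<in>{1..l}. B i (2 * k))}"
    using G unfolding class_G0_at_def mem_Collect_eq by (elim conjE exE) (rule that; assumption)
  have strip: "strip (2 * k) (H i) (B i)" if "i \<in> {1..l}" for i using strips that by blast
  define U where "U = R \<union> (\<Union>i\<in>{1..l}. B i (2 * k))"
  note arcs = H(4)[folded U_def]
  let ?lev = "\<lambda>i. strip_level (H i) (B i)"
  have "\<forall>i\<in>{1..l}. \<exists>x. B i 0 = {x}"
  proof
    fix i assume "i \<in> {1..l}"
    from strip[OF this] show "\<exists>x. B i 0 = {x}" unfolding strip_def by (elim conjE exE) (rule exI)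
  qed
  then obtain x where x0: "\<forall>i\<in>{1..l}. B i 0 = {x i}" by (rule bchoice[THEN exE])
  then have x: "B i 0 = {x i}" if "i \<in> {1..l}" for i using that by blast
  have xH: "x i \<in> pverts (H i)" if "i \<in> {1..l}" for i
    using strip_levelD[OF strip[OF that], of 0 "x i"] x[OF that] by simp
  have B: "v \<in> pverts (H i)" if "i \<in> {1..l}" "v \<in> B i (2 * k)" for i v
    using strip_levelD[OF strip[OF that(1)]] that(2) by blast
  have disj: "v \<notin> pverts (H j)" if "i \<in> {1..l}" "j \<in> {1..l}" "i \<noteq> j" "v \<in> pverts (H i)" for i j v
    using H(1) that unfolding disjoint_family_on_def by blast
  have U: "v \<in> B i (2 * k)" if v: "v \<in> U" and i: "i \<in> {1..l}" "v \<in> pverts (H i)" for i v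
  proof -
    have "v \<notin> R" using H(2) i by blast
    then obtain j where j: "j \<in> {1..l}" "v \<in> B j (2 * k)" using v unfolding U_def by blast
    then have "j = i" using disj[OF j(1) i(1)] B i(2) by blast
    then show ?thesis using j by simp
  qed
  have dist: "4 * k < vdist (x i) (x j)" if ij: "i \<in> {1..l}" "j \<in> {1..l}" "i \<noteq> j" for i j
  proof -
    have "2 * (2 * k) + 1 \<le> vdist (x i) (x j)"
    proof (rule strips_centre_dist[OF strip[OF ij(1)] x[OF ij(1)] strip[OF ij(2)] x[OF ij(2)]])
      show "pverts (H i) \<inter> pverts (H j) = {}" using disj[OF ij] by blast
      show "pverts (H i) \<subseteq> pverts G" "pverts (H j) \<subseteq> pverts G" using H(3) ij by blast+
      fix a b assume "(a, b) \<in> parcs G"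
      then consider s where "s \<in> {1..l}" "(a, b) \<in> parcs (H s)" | "a \<in> U" "b \<in> U"
        using arcs by blast
      then show "(a, b) \<in> parcs (H i) \<or> (a, b) \<in> parcs (H j) \<or>
        (\<forall>v\<in>{a, b}. (v \<in> pverts (H i) \<longrightarrow> v \<in> B i (2 * k)) \<and> (v \<in> pverts (H j) \<longrightarrow> v \<in> B j (2 * k)))"
      proof cases
        case 1
        have ab: "a \<in> pverts (H s)" "b \<in> pverts (H s)"
          using strip_level_arc[OF strip[OF 1(1)] 1(2)] by simp_all
        show ?thesis
        proof (cases "s = i \<or> s = j")
          case True
          then show ?thesis using 1(2) by blast
        next
          case False
          then show ?thesis using disj[OF 1(1) ij(1)] disj[OF 1(1) ij(2)] ab by simp
        qed
      next
        case 2
        then show ?thesis using U ij by blast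
      qed
    qed
    then show ?thesis by simp
  qed
  have xG: "x i \<in> pverts G" if "i \<in> {1..l}" for i using xH that H(3) by blast
  have inj: "inj_on x {1..l}"
  proof (rule inj_onI)
    fix i j assume ij: "i \<in> {1..l}" "j \<in> {1..l}" "x i = x j"
    then show "i = j" using dist[of i j] vdist_self[OF xG[OF ij(2)]] by (cases "i = j") auto
  qed
  have "4 * k * card (x ` {1..l}) \<le> broadcast_independence_number G"
  proof (rule constant_broadcast)
    show "x ` {1..l} \<subseteq> pverts G" using xG by blast
    show "2 \<le> card (x ` {1..l})" using inj assms(2) by (simp add: card_image)
    show "4 * k < vdist u v" if "u \<in> x ` {1..l}" "v \<in> x ` {1..l}" "u \<noteq> v" for u v
      using that dist by blast
  qed
  then have "4 * k * l \<le> broadcast_independence_number G" using inj by (simp add: card_image)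
  \<comment> \<open>The index \<open>(0, 0)\<close> stands for \<open>U\<close> and cannot clash, as
    strips are numbered from 1. Level \<open>2 * k\<close> belongs to \<open>U\<close>, so only
    \<open>k\<close> pairs per strip remain.\<close>
  moreover have "independence_number G \<le> card (insert (0, 0) ({1..l} \<times> {..<k}))"
  proof (rule independence_number_le_clique_cover)
    let ?C = "\<lambda>(i, j). if i = 0 then U else {v \<in> pverts (H i). ?lev i v div 2 = j}"
    show "\<exists>i\<in>insert (0, 0) ({1..l} \<times> {..<k}). v \<in> ?C i" if v: "v \<in> pverts G" for v
    proof (cases "v \<in> U")
      case False
      then obtain i where i: "i \<in> {1..l}" "v \<in> pverts (H i)" using v H(3) unfolding U_def by blast
      note lev = strip_level_mem[OF strip[OF i(1)] i(2)]
      have "v \<notin> B i (2 * k)" using False i(1) unfolding U_def by blast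
      then have "?lev i v \<noteq> 2 * k" using lev by metis
      then have "?lev i v div 2 < k" using lev by linarith
      then show ?thesis using i by (intro bexI[of _ "(i, ?lev i v div 2)"]) auto
    qed auto
    show "(u, v) \<in> parcs G"
      if uv: "p \<in> insert (0, 0) ({1..l} \<times> {..<k})" "u \<in> ?C p" "v \<in> ?C p" "u \<noteq> v" for p u v
    proof -
      obtain i j where p: "p = (i, j)" by (cases p)
      show ?thesis
      proof (cases "i = 0")
        case True
        then have "u \<in> U" "v \<in> U" using uv(2,3) p by simp_all
        then show ?thesis unfolding arcs using uv(4) by blast
      next
        case False
        then have i: "i \<in> {1..l}" using uv(1) p by auto
        have "(u, v) \<in> parcs (H i)"
          using strip_level_adjacent[OF strip[OF i], of u v] uv(2-4) False p by simp
        then show ?thesis unfolding arcs using i by blast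
      qed
    qed
  qed simp
  then have "independence_number G \<le> Suc (l * k)"
    by (subst (asm) card_insert_disjoint) (simp_all add: card_cartesian_product)
  ultimately show ?thesis by (simp add: algebra_simps)
qed

lemma class_bound:
  assumes "G \<in> class_G0 \<union> class_G2"
  shows "4 * independence_number G \<le> broadcast_independence_number G + 4"
  using assms class_G0_at_bound class_G2_at_bound by (auto simp: class_G0_def class_G2_def)

end

theorem theorem1p1:
  fixes G :: "'a pair_pre_digraph" and f :: "'a \<Rightarrow> nat" and fmax :: nat
  assumes "pair_graph G" and "connected (with_proj G)"
    and "graph_diameter G \<ge> 3 \<or> independence_number G \<ge> 3"
    and "optimal_broadcast G f"
    and "fmax = Max (f ` pverts G)"
  shows "real (broadcast_independence_number G) \<le>
           4 * real (independence_number G)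
             - 4 * min 1 (2 * real (independence_number G) / (real fmax + 2))
         \<and>
         (real (broadcast_independence_number G) =
           4 * real (independence_number G)
             - 4 * min 1 (2 * real (independence_number G) / (real fmax + 2))
          \<longleftrightarrow> G \<in> class_G0 \<union> class_G2)"
proof -
  interpret connected_pair_graph G
    using assms(1,2) by (simp add: connected_pair_graph_def connected_pair_graph_axioms_def)
  have f: "independent_broadcast G f"
    and weight: "broadcast_weight G f = broadcast_independence_number G"
    using assms(4) by (simp_all add: optimal_broadcast_def)
  have two: "2 \<le> card {x \<in> pverts G. 0 < f x}"
    by (rule optimal_broadcast_support[OF assms(4,3)])
  then have "pverts G \<noteq> {}" by auto
  then have "fmax \<in> f ` pverts G" using assms(5) pair_finite_verts by simp
  then have "fmax + 2 \<le> 2 * independence_number G" using broadcast_value_bound[OF f two] by auto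
  then have "real (fmax + 2) \<le> real (2 * independence_number G)" by (rule of_nat_mono)
  then have "1 \<le> 2 * real (independence_number G) / (real fmax + 2)"
    by (simp add: le_divide_eq)
  then have min: "min 1 (2 * real (independence_number G) / (real fmax + 2)) = 1" by simp
  \<comment> \<open>With the minimum equal to 1, \<open>class_bound\<close> reverses the inequality
    for members of the classes and thus gives equality.\<close>
  show ?thesis
    using broadcast_weight_bound[OF f two] class_bound unfolding min weight by linarith
qed

end
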